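(* Let $\mathbf{A}\in\mathbb{R}^{n\times d}$ be nonzero, $\mathbf{b}\in\operatorname{range}(\mathbf{A})$, and $0<\varepsilon<1/4$. Run the algorithm described in the context with parameters $\alpha = 1/\|\mathbf{A}\|^2$, $R = \lceil 2\kappa_{\mathsf F}^2/\kappa^2\rceil$, $C=\lceil 10\kappa_{\mathsf F}^2/\varepsilon^2\rceil$, $K=\lceil 4\kappa^2\log(1/\varepsilon)\rceil$, and let $\mathbf{y}$ be its output. Then there is an absolute constant $\mathrm{const}$ such that, with probability at least $9/10$, $$\phi(\mathbf{y})\le \mathrm{const}\cdot\kappa_{\mathsf F}^2\kappa^6\log(1/\varepsilon)^3.$$
   Context: Notation: $\|\cdot\|$ is the Euclidean norm / spectral norm, $\|\cdot\|_{\mathsf F}$ the Frobenius norm, $\mathbf{A}^+$ the pseudoinverse, $\kappa:=\|\mathbf{A}\|\|\mathbf{A}^+\|$, $\kappa_{\mathsf F}:=\|\mathbf{A}\|_{\mathsf F}\|\mathbf{A}^+\|$. For $\mathbf{y}\in\mathbb{R}^n$, $\phi(\mathbf{y}):=\operatorname{nnz}(\mathbf{y})\sum_{r=1}^n\frac{|y_r|^2\|\mathbf{e}_r^{\mathsf T}\mathbf{A}\|^2}{\|\mathbf{A}^{\mathsf T}\mathbf{y}\|^2}$, where $\operatorname{nnz}$ is the number of nonzero entries. Let $p_r=\|\mathbf{e}_r^{\mathsf T}\mathbf{A}\|^2/\|\mathbf{A}\|_{\mathsf F}^2$ and $q_c=\|\mathbf{A}\mathbf{e}_c\|^2/\|\mathbf{A}\|_{\mathsf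 F}^2$. Algorithm: set $\mathbf{y}=\mathbf{0}\in\mathbb{R}^n$. For $k=1,\dots,K$: draw a list $\mathcal{C}_k$ of $C$ column indices i.i.d. from $q$; for each $c\in\mathcal{C}_k$ compute $\beta_c=\sum_iA_{i,c}y_i$ (with the current $\mathbf{y}$); draw a list $\mathcal{R}_k$ of $R$ row indices i.i.d. from $p$ (all draws independent); for each $r\in\mathcal{R}_k$ compute $\gamma_r=\big(\frac1C\sum_{c\in\mathcal{C}_k}q_c^{-1}A_{r,c}\beta_c\big)-b_r$ and update $y_r\gets y_r-\alpha\gamma_r/(Rp_r)$. Output the final $\mathbf{y}$. *)

theory Defs
  imports
    "HOL-Probability.Probability_Mass_Function"
    "Jordan_Normal_Form.Matrix"
begin

unbundle no vec_syntax

definition vnorm :: "real Matrix.vec \<Rightarrow> real" where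
  "vnorm v = L2_set (\<lambda>i. v $ i) {..<dim_vec v}"

definition spectral_norm :: "real mat \<Rightarrow> real" where
  "spectral_norm A = (SUP v \<in> {v \<in> carrier_vec (dim_col A). vnorm v \<le> 1}. vnorm (A *\<^sub>v v))"

definition frobenius_norm :: "real mat \<Rightarrow> real" where
  "frobenius_norm A = sqrt (\<Sum>i<dim_row A. \<Sum>j<dim_col A. (A $$ (i, j))\<^sup>2)"

text \<open>The Moore--Penrose pseudoinverse, characterised by the four Penrose equations.\<close>

definition is_pseudoinverse :: "real mat \<Rightarrow> real mat \<Rightarrow> bool" where
  "is_pseudoinverse A X \<longleftrightarrow>
     X \<in> carrier_mat (dim_col A) (dim_row A) \<and>
     A * X * A = A \<and>
     X * A * X = X \<and>
     transpose_mat (A * X) = A * X \<and>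
     transpose_mat (X * A) = X * A"

definition pseudoinverse :: "real mat \<Rightarrow> real mat" where
  "pseudoinverse A = (THE X. is_pseudoinverse A X)"

definition kappa :: "real mat \<Rightarrow> real" where
  "kappa A = spectral_norm A * spectral_norm (pseudoinverse A)"

definition kappa_F :: "real mat \<Rightarrow> real" where
  "kappa_F A = frobenius_norm A * spectral_norm (pseudoinverse A)"

definition mat_range :: "real mat \<Rightarrow> real Matrix.vec set" where
  "mat_range A = (\<lambda>x. A *\<^sub>v x) ` carrier_vec (dim_col A)"

definition nnz :: "real Matrix.vec \<Rightarrow> nat" where
  "nnz y = card {i. i < dim_vec y \<and> y $ i \<noteq> 0}"

text \<open>The quotient is taken in the extended reals, where \<open>a / 0 = \<infinity>\<close> for \<open>a > 0\<close> and
  \<open>0 / 0 = 0\<close>. Thus \<open>phi A 0 = 0\<close>, while a \<open>y\<close> with \<open>A\<^sup>T y = 0\<close> that puts weight on a nonzero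
  row of \<open>A\<close> has \<open>phi A y = \<infinity>\<close>; real division would give \<open>0\<close> for it.\<close>

definition phi :: "real mat \<Rightarrow> real Matrix.vec \<Rightarrow> ereal" where
  "phi A y = ereal (real (nnz y)) *
     (\<Sum>r<dim_vec y. ereal (\<bar>y $ r\<bar>\<^sup>2 * (vnorm (row A r))\<^sup>2) /
                     ereal ((vnorm (transpose_mat A *\<^sub>v y))\<^sup>2))"

definition row_prob :: "real mat \<Rightarrow> nat \<Rightarrow> real" where
  "row_prob A r = (vnorm (row A r))\<^sup>2 / (frobenius_norm A)\<^sup>2"

definition col_prob :: "real mat \<Rightarrow> nat \<Rightarrow> real" where
  "col_prob A c = (vnorm (col A c))\<^sup>2 / (frobenius_norm A)\<^sup>2"

text \<open>For \<open>A \<noteq> 0\<close> the weights below are nonnegative and sum to one, as \<open>embed_pmf\<close> requires.\<close>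

definition row_pmf :: "real mat \<Rightarrow> nat pmf" where
  "row_pmf A = embed_pmf (\<lambda>r. if r < dim_row A then row_prob A r else 0)"

definition col_pmf :: "real mat \<Rightarrow> nat pmf" where
  "col_pmf A = embed_pmf (\<lambda>c. if c < dim_col A then col_prob A c else 0)"

definition beta :: "real mat \<Rightarrow> real Matrix.vec \<Rightarrow> nat \<Rightarrow> real" where
  "beta A y c = (\<Sum>i<dim_row A. A $$ (i, c) * y $ i)"

definition gamma_est ::
  "real mat \<Rightarrow> real Matrix.vec \<Rightarrow> nat \<Rightarrow> (nat \<Rightarrow> real) \<Rightarrow> nat list \<Rightarrow> nat \<Rightarrow> real" where
  "gamma_est A b C \<beta> cs r =
     1 / real C * (\<Sum>c\<leftarrow>cs. inverse (col_prob A c) * A $$ (r, c) * \<beta> c) - b $ r"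

definition update_entry ::
  "real mat \<Rightarrow> real \<Rightarrow> nat \<Rightarrow> (nat \<Rightarrow> real) \<Rightarrow> nat \<Rightarrow> real Matrix.vec \<Rightarrow> real Matrix.vec" where
  "update_entry A \<alpha> R \<gamma> r y =
     Matrix.vec (dim_vec y)
       (\<lambda>i. if i = r then y $ r - \<alpha> * \<gamma> r / (real R * row_prob A r) else y $ i)"

text \<open>The values \<open>\<beta>\<close> are computed from the iterate at the start of the step, so they are
  unaffected by the entry updates. A row sampled several times is updated once per occurrence.\<close>

definition algo_step ::
  "real mat \<Rightarrow> real Matrix.vec \<Rightarrow> real \<Rightarrow> nat \<Rightarrow> nat \<Rightarrow> real Matrix.vec \<Rightarrow> real Matrix.vec pmf" where
  "algo_step A b \<alpha> R C y =
     do {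
       cs \<leftarrow> replicate_pmf C (col_pmf A);
       rs \<leftarrow> replicate_pmf R (row_pmf A);
       return_pmf (fold (update_entry A \<alpha> R (gamma_est A b C (beta A y) cs)) rs y)
     }"

primrec algo ::
  "real mat \<Rightarrow> real Matrix.vec \<Rightarrow> real \<Rightarrow> nat \<Rightarrow> nat \<Rightarrow> nat \<Rightarrow> real Matrix.vec pmf" where
  "algo A b \<alpha> R C 0 = return_pmf (0\<^sub>v (dim_row A))"
| "algo A b \<alpha> R C (Suc k) = bind_pmf (algo A b \<alpha> R C k) (algo_step A b \<alpha> R C)"

end

theory Submission
  imports Defs
begin

text \<open>
  Put \<open>x = A\<^sup>T y\<close>, \<open>x* = A\<^sup>+ b\<close>, \<open>e = x - x*\<close>, \<open>u = 1 / \<kappa>\<^sup>2\<close> and \<open>\<alpha> = 1 / \<parallel>A\<parallel>\<^sup>2\<close>. The iteration is a stochastic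
  gradient descent whose mean step is \<open>e \<mapsto> G e\<close> with \<open>G = 1 - \<alpha> A\<^sup>T A\<close>. Row sampling costs at most
  half of the contraction and column sampling adds noise proportional to \<open>\<parallel>x\<parallel>\<^sup>2\<close>, so that
  \<open>E \<parallel>e'\<parallel>\<^sup>2 \<le> (1 - u/2) \<parallel>e\<parallel>\<^sup>2 + (3/320) u \<parallel>x\<parallel>\<^sup>2\<close>. Since \<open>E e = - G\<^sup>k x*\<close> with \<open>G \<ge> 0\<close>, one has
  \<open>E \<parallel>x\<parallel>\<^sup>2 \<le> E \<parallel>e\<parallel>\<^sup>2 + \<parallel>x*\<parallel>\<^sup>2\<close>; this bound, sharper than \<open>2 E \<parallel>e\<parallel>\<^sup>2 + 2 \<parallel>x*\<parallel>\<^sup>2\<close>, is what leaves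
  \<open>E \<parallel>e\<parallel>\<^sup>2 \<le> 0.0867 \<parallel>x*\<parallel>\<^sup>2\<close> after \<open>K\<close> steps, and hence \<open>\<parallel>x\<parallel> \<ge> \<parallel>x*\<parallel> / 20\<close> with probability above
  \<open>9/10\<close>. The weighted norm \<open>\<Sum>r. \<parallel>A\<^sub>r\<parallel>\<^sup>2 y\<^sub>r\<^sup>2\<close> grows per step by a factor \<open>1 + 1/K\<close> and a summand of
  order \<open>K \<parallel>x*\<parallel>\<^sup>2\<close>, so it has mean \<open>O(K\<^sup>2 \<parallel>x*\<parallel>\<^sup>2)\<close>, and Markov's inequality with a large constant
  uses up only the small remaining probability. Finally \<open>nnz y \<le> R K\<close>.
\<close>

section \<open>Finitely supported expectations\<close>

lemma expectation_bind_finite: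
  fixes h :: "'b \<Rightarrow> real"
  assumes "finite (set_pmf p)" "\<And>x. x \<in> set_pmf p \<Longrightarrow> finite (set_pmf (f x))"
  shows "measure_pmf.expectation (p \<bind> f) h
       = measure_pmf.expectation p (\<lambda>x. measure_pmf.expectation (f x) h)"
  using assms by (simp add: pmf_expectation_bind[of "set_pmf p"] integral_measure_pmf[of "set_pmf p"])

lemma expectation_mono_finite:
  fixes f g :: "'a \<Rightarrow> real"
  assumes "finite (set_pmf p)" "\<And>x. x \<in> set_pmf p \<Longrightarrow> f x \<le> g x"
  shows "measure_pmf.expectation p f \<le> measure_pmf.expectation p g"
  using assms by (intro integral_mono_AE) (auto simp: integrable_measure_pmf_finite AE_measure_pmf_iff)

lemma expectation_cong_pmf:
  fixes f g :: "'a \<Rightarrow> real"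
  assumes "\<And>x. x \<in> set_pmf p \<Longrightarrow> f x = g x"
  shows "measure_pmf.expectation p f = measure_pmf.expectation p g"
  using assms by (intro integral_cong_AE) (auto simp: AE_measure_pmf_iff)

section \<open>Moments of sums of independent draws\<close>

lemma finite_set_replicate_pmf [simp]: "finite (set_pmf p) \<Longrightarrow> finite (set_pmf (replicate_pmf m p))"
  by (induction m) auto

lemma expectation_replicate_Suc:
  fixes h :: "'a list \<Rightarrow> real"
  assumes "finite (set_pmf p)"
  shows "measure_pmf.expectation (replicate_pmf (Suc m) p) h
       = measure_pmf.expectation p (\<lambda>x. measure_pmf.expectation (replicate_pmf m p) (\<lambda>xs. h (x # xs)))"
  using assms by (simp add: expectation_bind_finite)

lemma expectation_replicate_sum:
  fixes f :: "'a \<Rightarrow> real"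
  assumes "finite (set_pmf p)"
  shows "measure_pmf.expectation (replicate_pmf m p) (\<lambda>xs. \<Sum>x\<leftarrow>xs. f x)
       = m * measure_pmf.expectation p f"
proof (induction m)
  case (Suc m)
  then show ?case
    using assms unfolding expectation_replicate_Suc[OF assms]
    by (simp add: integrable_measure_pmf_finite algebra_simps)
qed simp

text \<open>Of the \<open>m * m\<close> pairs of draws, the \<open>m\<close> diagonal ones give the
  second moment and all others factor by independence. The real subtraction
  \<open>real m - 1\<close> keeps the formula polynomial in \<open>m\<close>, so that the induction
  closes by algebra.\<close>

lemma expectation_replicate_sum_square:
  fixes f :: "'a \<Rightarrow> real"
  assumes fin: "finite (set_pmf p)"
  shows "measure_pmf.expectation (replicate_pmf m p) (\<lambda>xs. (\<Sum>x\<leftarrow>xs. f x)\<^sup>2)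
       = m * measure_pmf.expectation p (\<lambda>x. (f x)\<^sup>2)
         + m * (real m - 1) * (measure_pmf.expectation p f)\<^sup>2"
proof (induction m)
  case (Suc m)
  note [simp] = integrable_measure_pmf_finite fin
  have "measure_pmf.expectation (replicate_pmf (Suc m) p) (\<lambda>xs. (\<Sum>x\<leftarrow>xs. f x)\<^sup>2)
     = measure_pmf.expectation p (\<lambda>x. measure_pmf.expectation (replicate_pmf m p)
         (\<lambda>xs. (f x)\<^sup>2 + 2 * f x * (\<Sum>x\<leftarrow>xs. f x) + (\<Sum>x\<leftarrow>xs. f x)\<^sup>2))"
    unfolding expectation_replicate_Suc[OF fin] by (simp add: power2_sum algebra_simps)
  also have "\<dots> = measure_pmf.expectation p (\<lambda>x. (f x)\<^sup>2 + 2 * f x * (m * measure_pmf.expectation p f)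
       + measure_pmf.expectation (replicate_pmf m p) (\<lambda>xs. (\<Sum>x\<leftarrow>xs. f x)\<^sup>2))"
    by (simp add: expectation_replicate_sum)
  also have "\<dots> = measure_pmf.expectation p (\<lambda>x. (f x)\<^sup>2) + 2 * m * (measure_pmf.expectation p f)\<^sup>2
       + measure_pmf.expectation (replicate_pmf m p) (\<lambda>xs. (\<Sum>x\<leftarrow>xs. f x)\<^sup>2)"
    by (simp add: power2_eq_square)
  finally show ?case
    unfolding Suc.IH by (simp add: algebra_simps power2_eq_square del: replicate_pmf.simps)
qed simp

lemma expectation_replicate_affine:
  fixes f :: "'a \<Rightarrow> real"
  assumes fin: "finite (set_pmf p)" and "m > 0"
  shows "measure_pmf.expectation (replicate_pmf m p) (\<lambda>xs. c + t / m * (\<Sum>x\<leftarrow>xs. f x))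
       = c + t * measure_pmf.expectation p f"
  using assms by (simp add: integrable_measure_pmf_finite expectation_replicate_sum)

text \<open>Bias-variance bound: the mean of \<open>m\<close> independent samples has variance at
  most the second moment divided by \<open>m\<close>. The negative term with the squared mean is
  dropped.\<close>

lemma expectation_replicate_affine_square_le:
  fixes f :: "'a \<Rightarrow> real"
  assumes fin: "finite (set_pmf p)" and m: "m > 0"
  shows "measure_pmf.expectation (replicate_pmf m p) (\<lambda>xs. (c + t / m * (\<Sum>x\<leftarrow>xs. f x))\<^sup>2)
       \<le> (c + t * measure_pmf.expectation p f)\<^sup>2 + t\<^sup>2 / m * measure_pmf.expectation p (\<lambda>x. (f x)\<^sup>2)"
proof -
  note [simp] = integrable_measure_pmf_finite fin
  let ?E = "measure_pmf.expectation p f" and ?Q = "measure_pmf.expectation p (\<lambda>x. (f x)\<^sup>2)"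
  have "measure_pmf.expectation (replicate_pmf m p) (\<lambda>xs. (c + t / m * (\<Sum>x\<leftarrow>xs. f x))\<^sup>2)
     = measure_pmf.expectation (replicate_pmf m p)
         (\<lambda>xs. c\<^sup>2 + 2 * c * t / m * (\<Sum>x\<leftarrow>xs. f x) + t\<^sup>2 / m\<^sup>2 * (\<Sum>x\<leftarrow>xs. f x)\<^sup>2)"
    by (simp add: power2_sum power_divide power_mult_distrib algebra_simps)
  also have "\<dots> = c\<^sup>2 + 2 * c * t / m * (m * ?E) + t\<^sup>2 / m\<^sup>2 * (m * ?Q + m * (real m - 1) * ?E\<^sup>2)"
    by (simp add: expectation_replicate_sum expectation_replicate_sum_square)
  also have "\<dots> = (c + t * ?E)\<^sup>2 + t\<^sup>2 / m * ?Q - t\<^sup>2 / m * ?E\<^sup>2"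
    using m by (simp add: field_simps power2_eq_square)
  also have "\<dots> \<le> (c + t * ?E)\<^sup>2 + t\<^sup>2 / m * ?Q"
    by simp
  finally show ?thesis .
qed

text \<open>The previous bound is summed over coordinates. Weights 1 serve Euclidean norms, squared
  row norms serve the numerator of \<open>phi\<close>.\<close>

lemma expectation_replicate_weighted_square_le:
  fixes f :: "'j \<Rightarrow> 'a \<Rightarrow> real"
  assumes fin: "finite (set_pmf p)" and m: "m > 0" and w: "\<And>j. j \<in> J \<Longrightarrow> 0 \<le> w j"
  shows "measure_pmf.expectation (replicate_pmf m p)
           (\<lambda>xs. \<Sum>j\<in>J. w j * (c j + t / m * (\<Sum>x\<leftarrow>xs. f j x))\<^sup>2)
       \<le> (\<Sum>j\<in>J. w j * (c j + t * measure_pmf.expectation p (f j))\<^sup>2)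
         + t\<^sup>2 / m * measure_pmf.expectation p (\<lambda>x. \<Sum>j\<in>J. w j * (f j x)\<^sup>2)"
proof -
  note [simp] = integrable_measure_pmf_finite fin
  have "measure_pmf.expectation (replicate_pmf m p)
           (\<lambda>xs. \<Sum>j\<in>J. w j * (c j + t / m * (\<Sum>x\<leftarrow>xs. f j x))\<^sup>2)
     = (\<Sum>j\<in>J. w j * measure_pmf.expectation (replicate_pmf m p)
           (\<lambda>xs. (c j + t / m * (\<Sum>x\<leftarrow>xs. f j x))\<^sup>2))"
    by simp
  also have "\<dots> \<le> (\<Sum>j\<in>J. w j * ((c j + t * measure_pmf.expectation p (f j))\<^sup>2
         + t\<^sup>2 / m * measure_pmf.expectation p (\<lambda>x. (f j x)\<^sup>2)))"
    by (intro sum_mono mult_left_mono expectation_replicate_affine_square_le fin m w)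
  also have "\<dots> = (\<Sum>j\<in>J. w j * (c j + t * measure_pmf.expectation p (f j))\<^sup>2)
         + t\<^sup>2 / m * measure_pmf.expectation p (\<lambda>x. \<Sum>j\<in>J. w j * (f j x)\<^sup>2)"
    by (simp add: algebra_simps sum.distrib sum_distrib_left)
  finally show ?thesis .
qed

lemma markov_pmf_finite:
  fixes f :: "'a \<Rightarrow> real"
  assumes "finite (set_pmf p)" "\<And>x. 0 \<le> f x" "t > 0" "measure_pmf.expectation p f \<le> s"
  shows "measure_pmf.prob p {x. t \<le> f x} \<le> s / t"
proof -
  have "measure_pmf.prob p {x \<in> space (measure_pmf p). f x \<ge> t} \<le> measure_pmf.expectation p f / t"
    using assms by (intro integral_Markov_inequality_measure[where A="{}"]) (auto simp: integrable_measure_pmf_finite)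
  also have "\<dots> \<le> s / t" using assms by (intro divide_right_mono) auto
  finally show ?thesis by simp
qed

lemma expectation_embed_pmf_finite:
  fixes q f :: "nat \<Rightarrow> real"
  assumes "\<And>i. i < n \<Longrightarrow> 0 \<le> q i" "(\<Sum>i<n. q i) = 1"
  defines "p \<equiv> embed_pmf (\<lambda>i. if i < n then q i else 0)"
  shows "set_pmf p \<subseteq> {..<n}" "measure_pmf.expectation p f = (\<Sum>i<n. q i * f i)"
proof -
  have nn: "(\<integral>\<^sup>+i. ennreal (if i < n then q i else 0) \<partial>count_space UNIV) = 1"
  proof -
    have "(\<integral>\<^sup>+i. ennreal (if i < n then q i else 0) \<partial>count_space UNIV)
        = (\<Sum>i<n. ennreal (q i))"
      by (subst nn_integral_count_space'[where A="{..<n}"]) auto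
    also have "\<dots> = 1" using assms by (subst sum_ennreal) auto
    finally show ?thesis .
  qed
  have pmf: "pmf p i = (if i < n then q i else 0)" for i
    unfolding p_def using assms(1) nn by (subst pmf_embed_pmf) auto
  show sub: "set_pmf p \<subseteq> {..<n}"
    by (auto simp: set_pmf_eq pmf split: if_splits)
  show "measure_pmf.expectation p f = (\<Sum>i<n. q i * f i)"
    using sub by (subst integral_measure_pmf[of "{..<n}"]) (auto simp: pmf)
qed

section \<open>Pseudoinverse and matrix norms\<close>

lemma mult_mat_vec_nth:
  assumes "A \<in> carrier_mat n d" "v \<in> carrier_vec d" "i < n"
  shows "(A *\<^sub>v v) $ i = (\<Sum>j<d. A $$ (i, j) * v $ j)"
  using assms by (auto simp: scalar_prod_def lessThan_atLeast0 intro!: sum.cong)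

lemma mult_mat_nth:
  assumes "A \<in> carrier_mat n d" "B \<in> carrier_mat d m" "i < n" "j < m"
  shows "(A * B) $$ (i, j) = (\<Sum>k<d. A $$ (i, k) * B $$ (k, j))"
  using assms by (auto simp: scalar_prod_def lessThan_atLeast0 intro!: sum.cong)

section \<open>Existence and uniqueness of the pseudoinverse\<close>

lemma ex_orthogonal_residual:
  fixes f :: "nat \<Rightarrow> nat \<Rightarrow> real"
  shows "\<exists>c. \<forall>i<k. (\<Sum>x<n. f i x * (b x - (\<Sum>j<k. c j * f j x))) = 0"
proof (induction k arbitrary: b)
  case (Suc k)
  txt \<open>Gram--Schmidt: \<open>g\<close> and \<open>h\<close> are the residuals of \<open>f k\<close> and \<open>b\<close> modulo the first \<open>k\<close> vectors.\<close>
  define ip where "ip u v = (\<Sum>x<n. u x * v x)" for u v :: "nat \<Rightarrow> real"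
  have ip_diff: "ip u (\<lambda>x. v x - s * w x) = ip u v - s * ip u w" for u v w s
    by (simp add: ip_def algebra_simps sum_subtractf sum_distrib_left)
  have ip_diff': "ip (\<lambda>x. v x - w x) u = ip v u - ip w u" for u v w
    by (simp add: ip_def algebra_simps sum_subtractf)
  obtain c where c: "\<forall>i<k. ip (f i) (\<lambda>x. f k x - (\<Sum>j<k. c j * f j x)) = 0"
    using Suc.IH[of "f k"] unfolding ip_def by blast
  obtain e where e: "\<forall>i<k. ip (f i) (\<lambda>x. b x - (\<Sum>j<k. e j * f j x)) = 0"
    using Suc.IH[of b] unfolding ip_def by blast
  define g where "g x = f k x - (\<Sum>j<k. c j * f j x)" for x
  define h where "h x = b x - (\<Sum>j<k. e j * f j x)" for x
  have span: "ip (\<lambda>x. \<Sum>j<k. c j * f j x) u = (\<Sum>j<k. c j * ip (f j) u)" for u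
    unfolding ip_def sum_distrib_right sum_distrib_left
    by (subst sum.swap) (simp add: algebra_simps)
  have gf: "ip (f i) g = 0" and hf: "ip (f i) h = 0" if "i < k" for i
    using c e that by (auto simp: g_def[abs_def] h_def[abs_def])
  have fk: "ip (f k) u = ip g u + (\<Sum>j<k. c j * ip (f j) u)" for u
    using ip_diff'[of "f k" "\<lambda>x. \<Sum>j<k. c j * f j x" u] span[of u] by (simp add: g_def[abs_def])
  define s where "s = ip g h / ip g g"
  have s: "ip g (\<lambda>x. h x - s * g x) = 0"
  proof (cases "ip g g = 0")
    case True
    then have "\<forall>x<n. g x = 0"
      unfolding ip_def by (subst (asm) sum_nonneg_eq_0_iff) auto
    then show ?thesis by (simp add: ip_def)
  qed (simp add: ip_diff, simp add: s_def)
  define c' where "c' j = (if j < k then e j - s * c j else s)" for j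
  have eq: "b x - (\<Sum>j<Suc k. c' j * f j x) = h x - s * g x" for x
  proof -
    have "(\<Sum>j<k. c' j * f j x) = (\<Sum>j<k. e j * f j x) - s * (\<Sum>j<k. c j * f j x)"
      unfolding sum_distrib_left sum_subtractf[symmetric]
      by (intro sum.cong) (auto simp: c'_def algebra_simps)
    then show ?thesis by (simp add: c'_def g_def h_def algebra_simps)
  qed
  have small: "ip (f i) (\<lambda>x. h x - s * g x) = 0" if "i < k" for i
    using that gf hf by (simp add: ip_diff)
  have "ip (f i) (\<lambda>x. h x - s * g x) = 0" if "i < Suc k" for i
  proof (cases "i = k")
    case True
    then show ?thesis using fk[of "\<lambda>x. h x - s * g x"] s small by simp
  qed (use that small in auto)
  then show ?case
    unfolding ip_def by (intro exI[of _ c']) (simp only: eq, simp)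
qed simp

text \<open>Column \<open>l\<close> of \<open>Y\<close> holds least-squares coefficients of the
  \<open>l\<close>-th unit vector over the columns of \<open>A\<close>; orthogonality of every
  residual to these columns is the normal equation.\<close>

lemma ex_normal_equation_solution:
  assumes A: "A \<in> carrier_mat n d"
  obtains Y where "Y \<in> carrier_mat d n" "transpose_mat A * (A * Y) = (transpose_mat A :: real mat)"
proof -
  have "\<forall>l. \<exists>c. \<forall>i<d. (\<Sum>x<n. A $$ (x, i) * ((if x = l then 1 else 0) - (\<Sum>j<d. c j * A $$ (x, j)))) = 0"
    by (intro allI ex_orthogonal_residual[where f = "\<lambda>j x. A $$ (x, j)"])
  from choice[OF this] obtain c where
    c: "\<And>l i. i < d \<Longrightarrow> (\<Sum>x<n. A $$ (x, i) * ((if x = l then 1 else 0) - (\<Sum>j<d. c l j * A $$ (x, j)))) = 0"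
    by blast
  define Y where "Y = mat d n (\<lambda>(j, l). c l j)"
  have Y: "Y \<in> carrier_mat d n" by (simp add: Y_def)
  have "transpose_mat A * (A * Y) = transpose_mat A"
  proof (rule eq_matI)
    fix i l assume "i < dim_row (transpose_mat A)" "l < dim_col (transpose_mat A)"
    then have il: "i < d" "l < n" using A by auto
    have "(transpose_mat A * (A * Y)) $$ (i, l) = (\<Sum>x<n. A $$ (x, i) * (A * Y) $$ (x, l))"
      using A Y il by (subst mult_mat_nth[of _ d n _ n]) auto
    also have "\<dots> = (\<Sum>x<n. A $$ (x, i) * (\<Sum>j<d. c l j * A $$ (x, j)))"
    proof (intro sum.cong refl)
      fix x assume "x \<in> {..<n}"
      then have "(A * Y) $$ (x, l) = (\<Sum>j<d. c l j * A $$ (x, j))"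
        using il mult_mat_nth[OF A Y, of x l] by (simp add: Y_def mult.commute)
      then show "A $$ (x, i) * (A * Y) $$ (x, l) = A $$ (x, i) * (\<Sum>j<d. c l j * A $$ (x, j))"
        by simp
    qed
    also have "\<dots> = (\<Sum>x<n. A $$ (x, i) * (if x = l then 1 else 0))"
      using c[OF il(1), of l] by (simp add: algebra_simps sum_subtractf)
    also have "\<dots> = transpose_mat A $$ (i, l)"
      using A il by (simp add: sum.delta' mult.commute if_distrib[of "\<lambda>z. _ * z"] cong: if_cong)
    finally show "(transpose_mat A * (A * Y)) $$ (i, l) = transpose_mat A $$ (i, l)" .
  qed (use A Y in auto)
  with Y that show thesis by blast
qed

text \<open>Multiplying the normal equation by the transpose of \<open>Y\<close> exhibits the
  transpose of \<open>A * Y\<close> as a Gram matrix, which is symmetric. So \<open>A * Y\<close> is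
  the orthogonal projection onto the column space.\<close>

lemma normal_equation_symmetric:
  assumes A: "A \<in> carrier_mat n d" and Y: "Y \<in> carrier_mat d n"
    and eq: "transpose_mat A * (A * Y) = (transpose_mat A :: real mat)"
  shows "transpose_mat (A * Y) = A * Y" "A * Y * A = A"
proof -
  have "transpose_mat (A * Y) = transpose_mat Y * (transpose_mat A * (A * Y))"
    using A Y by (simp add: eq transpose_mult)
  also have "\<dots> = transpose_mat (A * Y) * (A * Y)"
    using A Y by (simp add: transpose_mult[OF A Y] assoc_mult_mat[of _ n d _ n _ n])
  finally have 1: "transpose_mat (A * Y) = transpose_mat (A * Y) * (A * Y)" .
  then have "A * Y = transpose_mat (transpose_mat (A * Y) * (A * Y))"
    by (metis transpose_transpose)
  also have "\<dots> = transpose_mat (A * Y) * (A * Y)"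
    using A Y by (subst transpose_mult[of _ n n _ n]) auto
  finally show sym: "transpose_mat (A * Y) = A * Y" using 1 by simp
  have "A = transpose_mat (transpose_mat A * (A * Y))" by (simp add: eq)
  also have "\<dots> = transpose_mat (A * Y) * A"
    using A Y by (subst transpose_mult[of _ d n _ n]) auto
  finally show "A * Y * A = A" using sym by simp
qed

lemma ex_pseudoinverse: "\<exists>X. is_pseudoinverse A X"
proof -
  define n d where "n = dim_row A" and "d = dim_col A"
  have A: "A \<in> carrier_mat n d" by (simp add: n_def d_def)
  obtain Y where Y: "Y \<in> carrier_mat d n" "transpose_mat A * (A * Y) = transpose_mat A"
    using ex_normal_equation_solution[OF A] .
  have At: "transpose_mat A \<in> carrier_mat d n" using A by simp
  obtain Z where Z: "Z \<in> carrier_mat n d"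
    "transpose_mat (transpose_mat A) * (transpose_mat A * Z) = transpose_mat (transpose_mat A)"
    using ex_normal_equation_solution[OF At] .
  define W where "W = transpose_mat Z"
  have W: "W \<in> carrier_mat d n" using Z by (simp add: W_def)
  note AY = normal_equation_symmetric[OF A Y]
  note AZ = normal_equation_symmetric[OF At Z]
  have WA: "W * A = transpose_mat A * Z"
    using AZ(1) A Z by (simp add: W_def transpose_mult[OF At Z(1)])
  have AWA: "A * (W * A) = A"
  proof -
    have "A * (W * A) = A * transpose_mat (transpose_mat A * Z)" using WA AZ by simp
    also have "\<dots> = transpose_mat (transpose_mat A * Z * transpose_mat A)"
      using A Z by (subst transpose_mult[of _ d d _ n]) auto
    finally show ?thesis using AZ(2) by simp
  qed
  \<comment> \<open>\<open>A * Y\<close> and \<open>W * A\<close> are the orthogonal projections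
    onto the column space and the row space of \<open>A\<close>. The product
    \<open>W * A * Y\<close> has both of them as its one-sided products with \<open>A\<close>, which
    yields the Penrose equations.\<close>
  define X where "X = W * A * Y"
  have X: "X \<in> carrier_mat d n" using A W Y by (simp add: X_def)
  have AX: "A * X = A * Y"
  proof -
    have "A * X = A * (W * A) * Y" using A W Y unfolding X_def
      by (subst assoc_mult_mat[of A n d "W * A" d Y n]) auto
    then show ?thesis by (simp add: AWA)
  qed
  have XA: "X * A = W * A"
  proof -
    have "X * A = W * (A * Y * A)" using A W Y unfolding X_def
      by (simp add: assoc_mult_mat[of W d n A d Y n] assoc_mult_mat[of W d n "A * Y" n A d])
    then show ?thesis by (simp add: AY)
  qed
  have "X * A * X = X"
  proof -
    have "X * A * X = W * A * (W * A * Y)" by (simp only: XA) (simp add: X_def)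
    also have "\<dots> = W * A * (W * A) * Y" using A W Y
      by (subst assoc_mult_mat[of _ d d _ d _ n]) auto
    also have "W * A * (W * A) = W * (A * (W * A))" using A W
      by (subst assoc_mult_mat[of _ d n _ d _ d]) auto
    finally have "X * A * X = W * (A * (W * A)) * Y" .
    then show ?thesis by (simp only: AWA X_def)
  qed
  moreover have "transpose_mat (X * A) = X * A" using XA WA AZ by simp
  ultimately have "is_pseudoinverse A X"
    using X AX AY A by (simp add: is_pseudoinverse_def)
  then show ?thesis ..
qed

text \<open>Each of \<open>A * X\<close> and \<open>A * X'\<close> absorbs the other and both are
  symmetric, so transposing a product identifies them; likewise on the other side. Then
  \<open>X = X * A * X = X * A * X' = X' * A * X' = X'\<close>.\<close>

lemma pseudoinverse_unique:
  assumes X: "is_pseudoinverse A X" and X': "is_pseudoinverse A X'"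
  shows "X = X'"
proof -
  define n d where "n = dim_row A" and "d = dim_col A"
  have A: "A \<in> carrier_mat n d" by (simp add: n_def d_def)
  have c: "X \<in> carrier_mat d n" "X' \<in> carrier_mat d n"
    using X X' by (auto simp: is_pseudoinverse_def n_def d_def)
  note P = X[unfolded is_pseudoinverse_def] X'[unfolded is_pseudoinverse_def]
  have L: "A * U * (A * V) = A * V"
    if "A * U * A = A" "U \<in> carrier_mat d n" "V \<in> carrier_mat d n" for U V
    using A that assoc_mult_mat[of "A * U" n n A d V n] by simp
  have R: "V * A * (U * A) = V * A"
    if "A * U * A = A" "U \<in> carrier_mat d n" "V \<in> carrier_mat d n" for U V
  proof -
    have "V * A * (U * A) = V * (A * (U * A))"
      using A that by (intro assoc_mult_mat) auto
    also have "A * (U * A) = A * U * A"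
      using A that by (intro assoc_mult_mat[symmetric]) auto
    finally show ?thesis using that by simp
  qed
  have "A * X = A * X' * (A * X)"
    using L[of X' X] P c by simp
  also have "\<dots> = transpose_mat (A * X * (A * X'))"
    using P A c by (subst transpose_mult[of _ n n _ n]) auto
  also have "A * X * (A * X') = A * X'"
    using L[of X X'] P c by simp
  finally have 1: "A * X = A * X'" using P by simp
  have "X * A = X * A * (X' * A)"
    using R[of X' X] P c by simp
  also have "\<dots> = transpose_mat (X' * A * (X * A))"
    using P A c by (subst transpose_mult[of _ d d _ d]) auto
  also have "X' * A * (X * A) = X' * A"
    using R[of X X'] P c by simp
  finally have 2: "X * A = X' * A" using P by simp
  have "X = X * (A * X)" using P assoc_mult_mat[OF c(1) A c(1)] by simp
  also have "\<dots> = X * A * X'" using A c by (simp add: 1 assoc_mult_mat[of X d n A d X' n])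
  also have "\<dots> = X'" using 2 P by simp
  finally show ?thesis .
qed

lemma is_pseudoinverse_pseudoinverse: "is_pseudoinverse A (pseudoinverse A)"
  unfolding pseudoinverse_def
  using ex_pseudoinverse pseudoinverse_unique by (metis theI')

section \<open>Vector and matrix norm inequalities\<close>

lemma vnorm_square: "(vnorm v)\<^sup>2 = (\<Sum>i<dim_vec v. (v $ i)\<^sup>2)"
  by (simp add: vnorm_def L2_set_def sum_nonneg)

lemma vnorm_nonneg [simp]: "0 \<le> vnorm v"
  by (simp add: vnorm_def)

lemma vnorm_smult: "vnorm (s \<cdot>\<^sub>v v) = \<bar>s\<bar> * vnorm v"
  by (simp add: vnorm_def L2_set_def power_mult_distrib sum_distrib_left[symmetric] real_sqrt_mult)

lemma frobenius_norm_square: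
  "(frobenius_norm A)\<^sup>2 = (\<Sum>i<dim_row A. \<Sum>j<dim_col A. (A $$ (i, j))\<^sup>2)"
  by (simp add: frobenius_norm_def sum_nonneg)

lemma frobenius_norm_nonneg [simp]: "0 \<le> frobenius_norm A"
  by (simp add: frobenius_norm_def sum_nonneg)

text \<open>Cauchy-Schwarz row by row. This crude bound shows that the supremum in
  \<open>spectral_norm\<close> runs over a bounded set, and it later gives
  \<open>kappa A \<le> kappa_F A\<close>.\<close>

lemma vnorm_mult_mat_vec_le_frobenius:
  assumes "v \<in> carrier_vec (dim_col A)"
  shows "vnorm (A *\<^sub>v v) \<le> frobenius_norm A * vnorm v"
proof (rule power2_le_imp_le)
  have "(vnorm (A *\<^sub>v v))\<^sup>2 = (\<Sum>i<dim_row A. (\<Sum>j<dim_col A. A $$ (i, j) * v $ j)\<^sup>2)"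
    using assms by (auto simp: vnorm_square mult_mat_vec_nth[OF carrier_matI[OF refl refl]] simp del: index_mult_mat_vec intro!: sum.cong)
  also have "\<dots> \<le> (\<Sum>i<dim_row A. (\<Sum>j<dim_col A. (A $$ (i, j))\<^sup>2) * (\<Sum>j<dim_col A. (v $ j)\<^sup>2))"
    by (intro sum_mono Cauchy_Schwarz_ineq_sum)
  also have "\<dots> = (frobenius_norm A * vnorm v)\<^sup>2"
    using assms by (simp add: power_mult_distrib frobenius_norm_square vnorm_square sum_distrib_right)
  finally show "(vnorm (A *\<^sub>v v))\<^sup>2 \<le> (frobenius_norm A * vnorm v)\<^sup>2" .
qed (simp add: mult_nonneg_nonneg)

lemma bdd_above_spectral:
  "bdd_above ((\<lambda>v. vnorm (A *\<^sub>v v)) ` {v \<in> carrier_vec (dim_col A). vnorm v \<le> 1})"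
proof (rule bdd_aboveI2)
  fix v assume "v \<in> {v \<in> carrier_vec (dim_col A). vnorm v \<le> 1}"
  then show "vnorm (A *\<^sub>v v) \<le> frobenius_norm A"
    using vnorm_mult_mat_vec_le_frobenius[of v A] mult_left_mono[of "vnorm v" 1 "frobenius_norm A"] by auto
qed

lemma spectral_norm_le_frobenius: "spectral_norm A \<le> frobenius_norm A"
  unfolding spectral_norm_def
proof (rule cSUP_least)
  have "vnorm (0\<^sub>v (dim_col A)) \<le> 1" by (simp add: vnorm_def L2_set_def)
  then show "{v \<in> carrier_vec (dim_col A). vnorm v \<le> 1} \<noteq> {}" by (auto intro!: exI[of _ "0\<^sub>v (dim_col A)"])
next
  fix v assume "v \<in> {v \<in> carrier_vec (dim_col A). vnorm v \<le> 1}"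
  then show "vnorm (A *\<^sub>v v) \<le> frobenius_norm A"
    using vnorm_mult_mat_vec_le_frobenius[of v A] mult_left_mono[of "vnorm v" 1 "frobenius_norm A"] by auto
qed

lemma vnorm_mult_mat_vec_le:
  assumes v: "v \<in> carrier_vec (dim_col A)"
  shows "vnorm (A *\<^sub>v v) \<le> spectral_norm A * vnorm v"
proof (cases "vnorm v = 0")
  case True
  then show ?thesis using vnorm_mult_mat_vec_le_frobenius[OF v] by simp
next
  case False
  let ?w = "(1 / vnorm v) \<cdot>\<^sub>v v"
  have "vnorm ?w = 1" using False by (simp add: vnorm_smult)
  then have "vnorm (A *\<^sub>v ?w) \<le> spectral_norm A"
    unfolding spectral_norm_def using v by (intro cSUP_upper bdd_above_spectral) auto
  moreover have "A *\<^sub>v ?w = (1 / vnorm v) \<cdot>\<^sub>v (A *\<^sub>v v)"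
    using v by (intro mult_mat_vec[of A "dim_row A" "dim_col A"]) auto
  moreover have "0 < vnorm v" using False by (simp add: less_le)
  ultimately show ?thesis by (simp add: vnorm_smult field_simps)
qed

lemma spectral_norm_nonneg: "0 \<le> spectral_norm A"
proof -
  have "vnorm (0\<^sub>v (dim_col A)) \<le> 1" by (simp add: vnorm_def L2_set_def)
  then have "vnorm (A *\<^sub>v 0\<^sub>v (dim_col A)) \<le> spectral_norm A"
    unfolding spectral_norm_def by (intro cSUP_upper bdd_above_spectral) auto
  then show ?thesis using vnorm_nonneg order_trans by blast
qed

lemma sum_mult_square_le_spectral:
  assumes A: "A \<in> carrier_mat n d"
  shows "(\<Sum>i<n. (\<Sum>j<d. A $$ (i, j) * v j)\<^sup>2) \<le> (spectral_norm A)\<^sup>2 * (\<Sum>j<d. (v j)\<^sup>2)"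
proof -
  let ?v = "Matrix.vec d v"
  have v: "?v \<in> carrier_vec d" by simp
  have "(vnorm (A *\<^sub>v ?v))\<^sup>2 \<le> (spectral_norm A * vnorm ?v)\<^sup>2"
    using A by (intro power_mono vnorm_mult_mat_vec_le) auto
  moreover have "(vnorm (A *\<^sub>v ?v))\<^sup>2 = (\<Sum>i<n. (\<Sum>j<d. A $$ (i, j) * v j)\<^sup>2)"
    unfolding vnorm_square using A
    by (intro sum.cong) (auto simp: mult_mat_vec_nth[OF A v] simp del: index_mult_mat_vec)
  ultimately show ?thesis by (simp add: vnorm_square power_mult_distrib)
qed

text \<open>Singular values are avoided: the squared norm \<open>T\<close> of the transposed product
  \<open>t\<close> is the inner product of \<open>w\<close> with \<open>A t\<close>. Cauchy-Schwarz
  bounds \<open>T * T\<close> by the claimed right-hand side times \<open>T\<close>, and one factor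
  cancels.\<close>

lemma sum_transpose_mult_square_le_spectral:
  assumes A: "A \<in> carrier_mat n d"
  shows "(\<Sum>j<d. (\<Sum>i<n. A $$ (i, j) * w i)\<^sup>2) \<le> (spectral_norm A)\<^sup>2 * (\<Sum>i<n. (w i)\<^sup>2)"
proof -
  define t where "t j = (\<Sum>i<n. A $$ (i, j) * w i)" for j
  define T where "T = (\<Sum>j<d. (t j)\<^sup>2)"
  have T_nonneg: "0 \<le> T" by (simp add: T_def sum_nonneg)
  have "T = (\<Sum>j<d. \<Sum>i<n. A $$ (i, j) * w i * t j)"
    by (simp add: T_def power2_eq_square sum_distrib_right[symmetric] t_def[symmetric])
  also have "\<dots> = (\<Sum>i<n. w i * (\<Sum>j<d. A $$ (i, j) * t j))"
    unfolding sum_distrib_left by (subst sum.swap) (simp add: ac_simps)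
  finally have "T\<^sup>2 \<le> (\<Sum>i<n. (w i)\<^sup>2) * (\<Sum>i<n. (\<Sum>j<d. A $$ (i, j) * t j)\<^sup>2)"
    using Cauchy_Schwarz_ineq_sum[of w "\<lambda>i. \<Sum>j<d. A $$ (i, j) * t j" "{..<n}"] by simp
  also have "\<dots> \<le> (\<Sum>i<n. (w i)\<^sup>2) * ((spectral_norm A)\<^sup>2 * T)"
    unfolding T_def by (intro mult_left_mono sum_mult_square_le_spectral[OF A] sum_nonneg) simp
  finally have "T * T \<le> ((spectral_norm A)\<^sup>2 * (\<Sum>i<n. (w i)\<^sup>2)) * T"
    by (simp add: power2_eq_square ac_simps)
  moreover have "0 \<le> (spectral_norm A)\<^sup>2 * (\<Sum>i<n. (w i)\<^sup>2)"
    by (simp add: sum_nonneg)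
  ultimately have "T \<le> (spectral_norm A)\<^sup>2 * (\<Sum>i<n. (w i)\<^sup>2)"
    using T_nonneg by (cases "T = 0") (auto simp: mult_le_cancel_right)
  then show ?thesis by (simp add: T_def t_def)
qed

text \<open>Row \<open>r\<close> is the image of the \<open>r\<close>-th unit vector under the
  transpose.\<close>

lemma row_square_le_spectral:
  assumes A: "A \<in> carrier_mat n d" and r: "r < n"
  shows "(\<Sum>j<d. (A $$ (r, j))\<^sup>2) \<le> (spectral_norm A)\<^sup>2"
proof -
  have "(\<Sum>i<n. A $$ (i, j) * (if i = r then 1 else 0)) = A $$ (r, j)" for j
    using r by (simp add: if_distrib[of "\<lambda>z. _ * z"] cong: if_cong)
  moreover have "(\<Sum>i<n. (if i = r then 1 else 0 :: real)\<^sup>2) = 1"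
    using r by (simp add: if_distrib[of "\<lambda>z. z\<^sup>2"] cong: if_cong)
  ultimately show ?thesis
    using sum_transpose_mult_square_le_spectral[OF A, of "\<lambda>i. if i = r then 1 else 0"] by simp
qed

section \<open>Action of the pseudoinverse on vectors\<close>

lemma pseudoinverse_carrier: "A \<in> carrier_mat n d \<Longrightarrow> pseudoinverse A \<in> carrier_mat d n"
  using is_pseudoinverse_pseudoinverse[of A] by (auto simp: is_pseudoinverse_def)

text \<open>Makes the pseudoinverse applied to \<open>b\<close> an exact solution when
  \<open>b\<close> lies in the range; it is also the source of
  \<open>1 \<le> kappa A\<close>.\<close>

lemma mult_pseudoinverse_mult_vec:
  assumes A: "A \<in> carrier_mat n d" and v: "v \<in> carrier_vec d"
  shows "A *\<^sub>v (pseudoinverse A *\<^sub>v (A *\<^sub>v v)) = A *\<^sub>v v"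
proof -
  let ?X = "pseudoinverse A"
  have X: "?X \<in> carrier_mat d n" using A by (rule pseudoinverse_carrier)
  have "A *\<^sub>v (?X *\<^sub>v (A *\<^sub>v v)) = (A * ?X) *\<^sub>v (A *\<^sub>v v)"
    using A X v by (subst assoc_mult_mat_vec[OF A X]) auto
  also have "\<dots> = (A * ?X * A) *\<^sub>v v"
    using A X v by (subst assoc_mult_mat_vec[of _ n n _ d]) auto
  also have "A * ?X * A = A"
    using is_pseudoinverse_pseudoinverse[of A] by (simp add: is_pseudoinverse_def)
  finally show ?thesis .
qed

text \<open>With \<open>X\<close> the pseudoinverse, \<open>X * A\<close> projects onto the row
  space, and both parts of \<open>e\<close> lie there: the first by transposing
  \<open>A * (X * A) = A\<close>, the second by \<open>X * A * X = X\<close>.\<close>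

lemma pseudoinverse_mult_vec_cancel:
  assumes A: "A \<in> carrier_mat n d" and w: "w \<in> carrier_vec n" and b: "b \<in> carrier_vec n"
  defines "e \<equiv> transpose_mat A *\<^sub>v w - pseudoinverse A *\<^sub>v b"
  shows "pseudoinverse A *\<^sub>v (A *\<^sub>v e) = e"
proof -
  let ?X = "pseudoinverse A"
  have X: "?X \<in> carrier_mat d n" using A by (rule pseudoinverse_carrier)
  have XA: "?X * A \<in> carrier_mat d d" using A X by simp
  have At: "transpose_mat A \<in> carrier_mat d n" using A by simp
  note P = is_pseudoinverse_pseudoinverse[of A, unfolded is_pseudoinverse_def]
  have "transpose_mat (?X * A) * transpose_mat A = transpose_mat (A * (?X * A))"
    using A X by (subst transpose_mult[OF A]) auto
  also have "A * (?X * A) = A"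
    using P A X by (subst assoc_mult_mat[OF A X A, symmetric]) simp
  finally have 1: "?X * A * transpose_mat A = transpose_mat A" using P by simp
  have "?X *\<^sub>v (A *\<^sub>v e) = (?X * A) *\<^sub>v e"
    unfolding e_def using A X At w b by (subst assoc_mult_mat_vec[OF X A]) auto
  also have "\<dots> = (?X * A) *\<^sub>v (transpose_mat A *\<^sub>v w) - (?X * A) *\<^sub>v (?X *\<^sub>v b)"
    unfolding e_def using X At w b by (intro mult_minus_distrib_mat_vec[OF XA]) auto
  also have "(?X * A) *\<^sub>v (transpose_mat A *\<^sub>v w) = transpose_mat A *\<^sub>v w"
    by (simp only: assoc_mult_mat_vec[OF XA At w, symmetric] 1)
  also have "(?X * A) *\<^sub>v (?X *\<^sub>v b) = ?X *\<^sub>v b"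
    using P by (simp add: assoc_mult_mat_vec[OF XA X b, symmetric])
  finally show ?thesis by (simp add: e_def)
qed

text \<open>The spectral norm of the pseudoinverse is applied to the identity
  \<open>e = A\<^sup>+ A e\<close>. This supplies the assumption \<open>lower\<close> of the locale
  below.\<close>

lemma sum_square_error_le:
  assumes A: "A \<in> carrier_mat n d" and b: "b \<in> carrier_vec n"
  defines "x \<equiv> \<lambda>j. (pseudoinverse A *\<^sub>v b) $ j"
  shows "(\<Sum>j<d. ((\<Sum>i<n. A $$ (i, j) * w i) - x j)\<^sup>2)
     \<le> (spectral_norm (pseudoinverse A))\<^sup>2
        * (\<Sum>k<n. (\<Sum>j<d. A $$ (k, j) * ((\<Sum>i<n. A $$ (i, j) * w i) - x j))\<^sup>2)"
proof -
  let ?X = "pseudoinverse A"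
  have X: "?X \<in> carrier_mat d n" using A by (rule pseudoinverse_carrier)
  have At: "transpose_mat A \<in> carrier_mat d n" using A by simp
  define wv where "wv = Matrix.vec n w"
  have wv: "wv \<in> carrier_vec n" by (simp add: wv_def)
  define e where "e = transpose_mat A *\<^sub>v wv - ?X *\<^sub>v b"
  have e: "e \<in> carrier_vec d" using X At wv b by (simp add: e_def)
  have e_nth: "e $ j = (\<Sum>i<n. A $$ (i, j) * w i) - x j" if "j < d" for j
  proof -
    have "(transpose_mat A *\<^sub>v wv) $ j = (\<Sum>i<n. A $$ (i, j) * w i)"
      unfolding mult_mat_vec_nth[OF At wv that] using that A by (simp add: wv_def)
    then show ?thesis using that X by (simp add: e_def x_def del: index_mult_mat_vec)
  qed
  have "e $ j = (\<Sum>k<n. ?X $$ (j, k) * (A *\<^sub>v e) $ k)" if "j < d" for j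
    using mult_mat_vec_nth[OF X _ that, of "A *\<^sub>v e"] A e pseudoinverse_mult_vec_cancel[OF A wv b]
    by (simp add: e_def[symmetric] del: index_mult_mat_vec)
  then have "(\<Sum>j<d. (e $ j)\<^sup>2) = (\<Sum>j<d. (\<Sum>k<n. ?X $$ (j, k) * (A *\<^sub>v e) $ k)\<^sup>2)"
    by (intro sum.cong) auto
  also have "\<dots> \<le> (spectral_norm ?X)\<^sup>2 * (\<Sum>k<n. ((A *\<^sub>v e) $ k)\<^sup>2)"
    by (rule sum_mult_square_le_spectral[OF X])
  finally show ?thesis
    by (simp add: e_nth mult_mat_vec_nth[OF A e] del: index_mult_mat_vec)
qed

lemma real_nat_ceiling_le: "0 \<le> x \<Longrightarrow> real (nat \<lceil>x\<rceil>) \<le> x + 1"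
  by linarith

text \<open>A nonzero entry in column \<open>j\<close> makes \<open>A v\<close> nonzero for the unit
  vector \<open>v\<close>. Passing \<open>A v\<close> through the pseudoinverse and back leaves it
  unchanged, so its norm is at most \<open>kappa A\<close> times itself.\<close>

lemma spectral_pos:
  assumes A: "A \<in> carrier_mat n d" and nz: "A \<noteq> 0\<^sub>m n d"
  shows "0 < spectral_norm A" "1 \<le> kappa A"
proof -
  let ?X = "pseudoinverse A"
  have X: "?X \<in> carrier_mat d n" using A by (rule pseudoinverse_carrier)
  obtain i j where ij: "i < n" "j < d" "A $$ (i, j) \<noteq> 0"
    using A nz by (metis carrier_matD eq_matI index_zero_mat(1-3))
  define v :: "real Matrix.vec" where "v = unit_vec d j"
  have v: "v \<in> carrier_vec d" by (simp add: v_def)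
  have Av: "A *\<^sub>v v \<in> carrier_vec n" using A v by simp
  have "(A *\<^sub>v v) $ i = (\<Sum>k<d. if k = j then A $$ (i, k) else 0)"
    unfolding mult_mat_vec_nth[OF A v ij(1)] using ij(2) by (intro sum.cong) (auto simp: v_def)
  also have "\<dots> = A $$ (i, j)" using ij(2) by simp
  finally have "0 < ((A *\<^sub>v v) $ i)\<^sup>2" using ij(3) by simp
  also have "\<dots> \<le> (vnorm (A *\<^sub>v v))\<^sup>2"
    unfolding vnorm_square using ij(1) A by (intro member_le_sum) auto
  finally have pos: "0 < vnorm (A *\<^sub>v v)" by (simp add: less_le)
  have le: "vnorm (A *\<^sub>v v) \<le> spectral_norm A * vnorm v"
    using A v by (intro vnorm_mult_mat_vec_le) auto
  show "0 < spectral_norm A"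
    using pos le spectral_norm_nonneg[of A] by (cases "spectral_norm A = 0") auto
  have "vnorm (A *\<^sub>v v) = vnorm (A *\<^sub>v (?X *\<^sub>v (A *\<^sub>v v)))"
    by (simp add: mult_pseudoinverse_mult_vec[OF A v])
  also have "\<dots> \<le> spectral_norm A * vnorm (?X *\<^sub>v (A *\<^sub>v v))"
    using A X Av by (intro vnorm_mult_mat_vec_le) auto
  also have "\<dots> \<le> spectral_norm A * (spectral_norm ?X * vnorm (A *\<^sub>v v))"
    using X Av by (intro mult_left_mono vnorm_mult_mat_vec_le spectral_norm_nonneg) auto
  finally show "1 \<le> kappa A" using pos by (simp add: kappa_def)
qed

section \<open>One step of the algorithm\<close>

lemma vnorm_row_square:
  assumes "A \<in> carrier_mat n d" "i < n"
  shows "(vnorm (Matrix.row A i))\<^sup>2 = (\<Sum>j<d. (A $$ (i, j))\<^sup>2)"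
  using assms by (auto simp: vnorm_square intro!: sum.cong)

lemma vnorm_col_square:
  assumes "A \<in> carrier_mat n d" "j < d"
  shows "(vnorm (Matrix.col A j))\<^sup>2 = (\<Sum>i<n. (A $$ (i, j))\<^sup>2)"
  using assms by (auto simp: vnorm_square intro!: sum.cong)

section \<open>Effect of the entry updates on an iterate\<close>

lemma dim_fold_update_entry [simp]: "dim_vec (fold (update_entry A \<alpha> R \<gamma>) rs y) = dim_vec y"
  by (induction rs arbitrary: y) (auto simp: update_entry_def)

text \<open>\<open>\<gamma>\<close> stays fixed along the list, so the updates add up regardless of
  their order and a repeated row counts with its multiplicity.\<close>

lemma fold_update_entry_nth:
  assumes "i < dim_vec y"
  shows "fold (update_entry A \<alpha> R \<gamma>) rs y $ i
       = y $ i + (- \<alpha>) / R * (\<Sum>r\<leftarrow>rs. if r = i then \<gamma> r / row_prob A r else 0)"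
  using assms
proof (induction rs arbitrary: y)
  case (Cons r rs)
  have "i < dim_vec (update_entry A \<alpha> R \<gamma> r y)"
    using Cons.prems by (simp add: update_entry_def)
  from Cons.IH[OF this] show ?case
    using Cons.prems by (simp add: update_entry_def algebra_simps)
qed simp

lemma nnz_update_entry: "nnz (update_entry A \<alpha> R \<gamma> r y) \<le> nnz y + 1"
proof -
  have "{i. i < dim_vec (update_entry A \<alpha> R \<gamma> r y) \<and> update_entry A \<alpha> R \<gamma> r y $ i \<noteq> 0}
      \<subseteq> insert r {i. i < dim_vec y \<and> y $ i \<noteq> 0}"
    by (auto simp: update_entry_def)
  then have "nnz (update_entry A \<alpha> R \<gamma> r y) \<le> card (insert r {i. i < dim_vec y \<and> y $ i \<noteq> 0})"
    unfolding nnz_def by (intro card_mono) auto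
  also have "\<dots> \<le> nnz y + 1"
    unfolding nnz_def by (simp add: card_insert_if)
  finally show ?thesis .
qed

lemma nnz_fold_update_entry: "nnz (fold (update_entry A \<alpha> R \<gamma>) rs y) \<le> nnz y + length rs"
proof (induction rs arbitrary: y)
  case (Cons r rs)
  show ?case
    using Cons.IH[of "update_entry A \<alpha> R \<gamma> r y"] nnz_update_entry[of A \<alpha> R \<gamma> r y] by simp
qed simp

text \<open>To be instantiated with \<open>xs = A\<^sup>+ b\<close>, \<open>\<sigma> = \<parallel>A\<parallel>\<^sup>2\<close>, \<open>F\<close> the squared Frobenius norm and \<open>u = 1 / \<kappa>\<^sup>2\<close>.
  The assumption \<open>lower\<close> is \<open>\<parallel>e\<parallel> \<le> \<parallel>A\<^sup>+\<parallel> \<parallel>A e\<parallel>\<close> for the errors \<open>e = A\<^sup>T w - xs\<close>, which lie in the row space.\<close>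

locale sampled_system =
  fixes A :: "real mat" and b :: "real Matrix.vec" and n d :: nat
    and xs :: "nat \<Rightarrow> real" and \<sigma> F u :: real and R C :: nat
  assumes A: "A \<in> carrier_mat n d"
    and F_def: "F = (\<Sum>i<n. \<Sum>j<d. (A $$ (i, j))\<^sup>2)"
    and F_pos: "0 < F" and \<sigma>_pos: "0 < \<sigma>" and u_pos: "0 < u" and u_le_1: "u \<le> 1"
    and op_norm: "\<And>w. (\<Sum>j<d. (\<Sum>i<n. A $$ (i, j) * w i)\<^sup>2) \<le> \<sigma> * (\<Sum>i<n. (w i)\<^sup>2)"
    and row_le: "\<And>i. i < n \<Longrightarrow> (\<Sum>j<d. (A $$ (i, j))\<^sup>2) \<le> \<sigma>"
    and lower: "\<And>w. u * \<sigma> * (\<Sum>j<d. ((\<Sum>i<n. A $$ (i, j) * w i) - xs j)\<^sup>2)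
        \<le> (\<Sum>k<n. (\<Sum>j<d. A $$ (k, j) * ((\<Sum>i<n. A $$ (i, j) * w i) - xs j))\<^sup>2)"
    and b_eq: "\<And>i. i < n \<Longrightarrow> b $ i = (\<Sum>j<d. A $$ (i, j) * xs j)"
    and R_ge: "2 * F \<le> \<sigma> * R" and C_ge: "160 * F \<le> u * \<sigma> * C"
begin

definition mv :: "(nat \<Rightarrow> real) \<Rightarrow> nat \<Rightarrow> real" where "mv v i = (\<Sum>j<d. A $$ (i, j) * v j)"
definition mtv :: "(nat \<Rightarrow> real) \<Rightarrow> nat \<Rightarrow> real" where "mtv w j = (\<Sum>i<n. A $$ (i, j) * w i)"
definition \<alpha> :: real where "\<alpha> = 1 / \<sigma>"
definition err :: "real Matrix.vec \<Rightarrow> nat \<Rightarrow> real" where "err y j = beta A y j - xs j"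
text \<open>The numerator of \<open>phi\<close>, apart from the factor \<open>nnz y\<close>.\<close>

definition wnorm :: "real Matrix.vec \<Rightarrow> real" where
  "wnorm y = (\<Sum>i<n. (\<Sum>j<d. (A $$ (i, j))\<^sup>2) * (y $ i)\<^sup>2)"

lemma dims [simp]: "dim_row A = n" "dim_col A = d"
  using A by auto

lemma R_pos: "R > 0" and C_pos: "C > 0"
  using R_ge C_ge F_pos by (auto intro!: Nat.gr0I)

lemma \<alpha>_pos: "\<alpha> > 0" and \<alpha>\<sigma>: "\<alpha> * \<sigma> = 1"
  using \<sigma>_pos by (auto simp: \<alpha>_def)

lemma row_prob_eq: "i < n \<Longrightarrow> row_prob A i = (\<Sum>j<d. (A $$ (i, j))\<^sup>2) / F"
  by (simp add: row_prob_def frobenius_norm_square vnorm_row_square[OF A] F_def)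

lemma col_prob_eq: "j < d \<Longrightarrow> col_prob A j = (\<Sum>i<n. (A $$ (i, j))\<^sup>2) / F"
  by (simp add: col_prob_def frobenius_norm_square vnorm_col_square[OF A] F_def)

lemma row_prob_nonneg: "i < n \<Longrightarrow> 0 \<le> row_prob A i"
  and col_prob_nonneg: "j < d \<Longrightarrow> 0 \<le> col_prob A j"
  using F_pos by (auto simp: row_prob_eq col_prob_eq sum_nonneg)

lemma row_prob_sum: "(\<Sum>i<n. row_prob A i) = 1"
  using F_pos by (simp add: row_prob_eq sum_divide_distrib[symmetric] F_def[symmetric])

lemma col_prob_sum: "(\<Sum>j<d. col_prob A j) = 1"
  using F_pos sum.swap[of "\<lambda>i j. (A $$ (i, j))\<^sup>2" "{..<d}" "{..<n}"]
  by (simp add: col_prob_eq sum_divide_distrib[symmetric] F_def[symmetric])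

lemma set_row_pmf: "set_pmf (row_pmf A) \<subseteq> {..<n}"
  and expectation_row_pmf: "measure_pmf.expectation (row_pmf A) f = (\<Sum>i<n. row_prob A i * f i)"
  using expectation_embed_pmf_finite[of n "row_prob A", OF row_prob_nonneg row_prob_sum]
  by (auto simp: row_pmf_def)

lemma set_col_pmf: "set_pmf (col_pmf A) \<subseteq> {..<d}"
  and expectation_col_pmf: "measure_pmf.expectation (col_pmf A) f = (\<Sum>j<d. col_prob A j * f j)"
  using expectation_embed_pmf_finite[of d "col_prob A", OF col_prob_nonneg col_prob_sum]
  by (auto simp: col_pmf_def)

lemma finite_row_pmf [simp]: "finite (set_pmf (row_pmf A))"
  and finite_col_pmf [simp]: "finite (set_pmf (col_pmf A))"
  using set_row_pmf set_col_pmf finite_subset by blast+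

text \<open>A row of probability zero vanishes, so the value 0 that HOL gives to a quotient by zero
  does not bias the importance-weighted estimates of products with \<open>A\<close>. Columns are
  treated alike.\<close>

lemma row_prob_0D: "row_prob A i = 0 \<Longrightarrow> i < n \<Longrightarrow> j < d \<Longrightarrow> A $$ (i, j) = 0"
  using F_pos by (simp add: row_prob_eq sum_nonneg_eq_0_iff)

lemma col_prob_0D: "col_prob A j = 0 \<Longrightarrow> i < n \<Longrightarrow> j < d \<Longrightarrow> A $$ (i, j) = 0"
  using F_pos by (simp add: col_prob_eq sum_nonneg_eq_0_iff)

lemma sum_row_square: "i < n \<Longrightarrow> (\<Sum>j<d. (A $$ (i, j))\<^sup>2) = row_prob A i * F"
  and sum_col_square: "j < d \<Longrightarrow> (\<Sum>i<n. (A $$ (i, j))\<^sup>2) = col_prob A j * F"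
  using F_pos by (auto simp: row_prob_eq col_prob_eq)

lemma op_norm_mtv: "(\<Sum>j<d. (mtv w j)\<^sup>2) \<le> \<sigma> * (\<Sum>i<n. (w i)\<^sup>2)"
  using op_norm by (simp add: mtv_def)

lemma adjoint: "(\<Sum>j<d. mtv w j * v j) = (\<Sum>i<n. w i * mv v i)"
  unfolding mv_def mtv_def sum_distrib_left sum_distrib_right
  by (subst sum.swap) (simp add: algebra_simps)

lemma mv_diff: "mv (\<lambda>j. v j - w j) i = mv v i - mv w i"
  and mtv_diff: "mtv (\<lambda>i. f i - g i) j = mtv f j - mtv g j"
  and mtv_scale: "mtv (\<lambda>i. s * f i) j = s * mtv f j"
  by (auto simp: mv_def mtv_def algebra_simps sum_subtractf sum_distrib_left)

lemma mtv_cong: "(\<And>i. i < n \<Longrightarrow> f i = g i) \<Longrightarrow> mtv f j = mtv g j"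
  by (auto simp: mtv_def)

lemma lower_err: "u * \<sigma> * (\<Sum>j<d. (err y j)\<^sup>2) \<le> (\<Sum>i<n. (mv (err y) i)\<^sup>2)"
  using lower[of "\<lambda>i. y $ i"] by (simp add: err_def[abs_def] beta_def mv_def)

lemma residual_eq: "i < n \<Longrightarrow> mv (beta A y) i - b $ i = mv (err y) i"
  by (simp add: err_def[abs_def] mv_diff b_eq) (simp add: mv_def)

text \<open>With \<open>\<alpha> = 1 / \<sigma>\<close> the quadratic term of the expansion is at
  most half of the decrease that the cross term brings.\<close>

lemma gradient_step_le:
  "(\<Sum>j<d. (e j - \<alpha> * mtv (mv e) j)\<^sup>2) \<le> (\<Sum>j<d. (e j)\<^sup>2) - \<alpha> * (\<Sum>i<n. (mv e i)\<^sup>2)"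
proof -
  have "(\<Sum>j<d. (e j - \<alpha> * mtv (mv e) j)\<^sup>2)
      = (\<Sum>j<d. (e j)\<^sup>2) - 2 * \<alpha> * (\<Sum>j<d. mtv (mv e) j * e j) + \<alpha>\<^sup>2 * (\<Sum>j<d. (mtv (mv e) j)\<^sup>2)"
    by (simp add: power2_diff power_mult_distrib sum.distrib sum_subtractf sum_distrib_left algebra_simps)
  also have "(\<Sum>j<d. mtv (mv e) j * e j) = (\<Sum>i<n. (mv e i)\<^sup>2)"
    by (simp add: adjoint power2_eq_square)
  also have "\<alpha>\<^sup>2 * (\<Sum>j<d. (mtv (mv e) j)\<^sup>2) \<le> \<alpha>\<^sup>2 * (\<sigma> * (\<Sum>i<n. (mv e i)\<^sup>2))"
    by (intro mult_left_mono op_norm_mtv) simp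
  also have "\<alpha>\<^sup>2 * (\<sigma> * (\<Sum>i<n. (mv e i)\<^sup>2)) = \<alpha> * (\<Sum>i<n. (mv e i)\<^sup>2)"
    using \<alpha>\<sigma> by (simp add: power2_eq_square)
  finally show ?thesis by simp
qed

section \<open>Moments of a single importance sample\<close>

lemma mean_row_sample:
  assumes "\<And>i. i < n \<Longrightarrow> row_prob A i = 0 \<Longrightarrow> g i = 0"
  shows "measure_pmf.expectation (row_pmf A) (\<lambda>i. g i * (\<gamma> i / row_prob A i)) = (\<Sum>i<n. g i * \<gamma> i)"
  unfolding expectation_row_pmf by (intro sum.cong) (use assms in auto)

lemma mean_col_sample:
  assumes "\<And>c. c < d \<Longrightarrow> col_prob A c = 0 \<Longrightarrow> g c = 0"
  shows "measure_pmf.expectation (col_pmf A) (\<lambda>c. inverse (col_prob A c) * g c) = (\<Sum>c<d. g c)"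
  unfolding expectation_col_pmf
proof (intro sum.cong refl)
  fix c assume "c \<in> {..<d}"
  then show "col_prob A c * (inverse (col_prob A c) * g c) = g c"
    using assms by (cases "col_prob A c = 0") auto
qed

text \<open>Sampling proportionally to squared row norms bounds \<open>h i / row_prob A i\<close> by
  \<open>F\<close> uniformly in \<open>i\<close>. Indices of probability zero contribute nothing on
  the left.\<close>

lemma second_moment_row_sample:
  assumes "\<And>i. i < n \<Longrightarrow> h i \<le> row_prob A i * F"
  shows "measure_pmf.expectation (row_pmf A) (\<lambda>i. h i * (\<gamma> i / row_prob A i)\<^sup>2) \<le> F * (\<Sum>i<n. (\<gamma> i)\<^sup>2)"
  unfolding expectation_row_pmf sum_distrib_left
proof (rule sum_mono)
  fix i assume "i \<in> {..<n}"
  then have i: "i < n" by simp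
  show "row_prob A i * (h i * (\<gamma> i / row_prob A i)\<^sup>2) \<le> F * (\<gamma> i)\<^sup>2"
  proof (cases "row_prob A i = 0")
    case False
    then have p: "row_prob A i > 0" using row_prob_nonneg[OF i] by simp
    have "row_prob A i * (h i * (\<gamma> i / row_prob A i)\<^sup>2) = h i / row_prob A i * (\<gamma> i)\<^sup>2"
      using p by (simp add: power2_eq_square)
    also have "\<dots> \<le> F * (\<gamma> i)\<^sup>2"
      using p assms[OF i] by (intro mult_right_mono) (auto simp: field_simps)
    finally show ?thesis .
  qed (use F_pos in simp)
qed

text \<open>The factor \<open>s\<close> is 1 for the residual estimate and \<open>\<sigma>\<close>
  for the gradient estimate, where one more multiplication by the transpose intervenes.\<close>

lemma second_moment_col_sample:
  assumes "\<And>c. c < d \<Longrightarrow> h c \<le> s * (col_prob A c * F)" "0 \<le> s"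
  shows "measure_pmf.expectation (col_pmf A) (\<lambda>c. h c * (inverse (col_prob A c) * \<beta> c)\<^sup>2)
       \<le> s * F * (\<Sum>c<d. (\<beta> c)\<^sup>2)"
  unfolding expectation_col_pmf sum_distrib_left
proof (rule sum_mono)
  fix c assume "c \<in> {..<d}"
  then have c: "c < d" by simp
  show "col_prob A c * (h c * (inverse (col_prob A c) * \<beta> c)\<^sup>2) \<le> s * F * (\<beta> c)\<^sup>2"
  proof (cases "col_prob A c = 0")
    case False
    then have p: "col_prob A c > 0" using col_prob_nonneg[OF c] by simp
    have "col_prob A c * (h c * (inverse (col_prob A c) * \<beta> c)\<^sup>2) = h c / col_prob A c * (\<beta> c)\<^sup>2"
      using p by (simp add: power2_eq_square field_simps)
    also have "\<dots> \<le> s * F * (\<beta> c)\<^sup>2"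
      using p assms(1)[OF c] by (intro mult_right_mono) (auto simp: field_simps)
    finally show ?thesis .
  qed (use F_pos assms(2) in simp)
qed

text \<open>\<open>A\<^sup>T y\<close> moves by an average of scaled rows. The indices have to be
  valid: an update at an invalid one leaves \<open>y\<close> alone, while the right-hand side would
  still list it.\<close>

lemma beta_fold_update_entry:
  assumes "dim_vec y = n" "set rs \<subseteq> {..<n}"
  shows "beta A (fold (update_entry A a R \<gamma>) rs y) j
       = beta A y j + (- a) / R * (\<Sum>r\<leftarrow>rs. A $$ (r, j) * (\<gamma> r / row_prob A r))"
  using assms
proof (induction rs arbitrary: y)
  case (Cons r rs)
  have r: "r < n" using Cons.prems by simp
  have "beta A (update_entry A a R \<gamma> r y) j
      = (\<Sum>i<n. A $$ (i, j) * y $ i + (if i = r then A $$ (r, j) * ((- a) / R * (\<gamma> r / row_prob A r)) else 0))"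
    unfolding beta_def dims using Cons.prems
    by (intro sum.cong) (auto simp: update_entry_def algebra_simps)
  also have "\<dots> = beta A y j + (- a) / R * (A $$ (r, j) * (\<gamma> r / row_prob A r))"
    using r by (simp add: sum.distrib beta_def)
  finally have step: "beta A (update_entry A a R \<gamma> r y) j
      = beta A y j + (- a) / R * (A $$ (r, j) * (\<gamma> r / row_prob A r))" .
  have "dim_vec (update_entry A a R \<gamma> r y) = n" using Cons.prems by (simp add: update_entry_def)
  from Cons.IH[OF this] show ?case
    using Cons.prems by (simp add: step algebra_simps)
qed simp

lemma set_rows: "rs \<in> set_pmf (replicate_pmf R (row_pmf A)) \<Longrightarrow> set rs \<subseteq> {..<n}"
  using set_row_pmf by (auto simp: set_replicate_pmf)

lemma err_fold_update_entry:
  assumes "dim_vec y = n" "rs \<in> set_pmf (replicate_pmf R (row_pmf A))"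
  shows "err (fold (update_entry A \<alpha> R \<gamma>) rs y) j
       = err y j + (- \<alpha>) / R * (\<Sum>r\<leftarrow>rs. A $$ (r, j) * (\<gamma> r / row_prob A r))"
  using beta_fold_update_entry[OF assms(1) set_rows[OF assms(2)]] by (simp add: err_def)

section \<open>Averages over the row draws\<close>

abbreviation E_rows :: "(nat list \<Rightarrow> real) \<Rightarrow> real" where
  "E_rows \<equiv> measure_pmf.expectation (replicate_pmf R (row_pmf A))"
abbreviation E_cols :: "(nat list \<Rightarrow> real) \<Rightarrow> real" where
  "E_cols \<equiv> measure_pmf.expectation (replicate_pmf C (col_pmf A))"

lemma mean_row_entry: "j < d \<Longrightarrow>
    measure_pmf.expectation (row_pmf A) (\<lambda>r. A $$ (r, j) * (\<gamma> r / row_prob A r)) = mtv \<gamma> j"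
  unfolding mtv_def by (rule mean_row_sample) (auto dest: row_prob_0D)

lemma rows_err:
  assumes "dim_vec y = n"
  shows "E_rows (\<lambda>rs. \<Sum>j<d. (err (fold (update_entry A \<alpha> R \<gamma>) rs y) j)\<^sup>2)
       \<le> (\<Sum>j<d. (err y j - \<alpha> * mtv \<gamma> j)\<^sup>2) + \<alpha>\<^sup>2 / R * (F * (\<Sum>i<n. (\<gamma> i)\<^sup>2))"
proof -
  \<comment> \<open>The factor 1 is the weight that the bias-variance bound expects.\<close>
  have "E_rows (\<lambda>rs. \<Sum>j<d. (err (fold (update_entry A \<alpha> R \<gamma>) rs y) j)\<^sup>2)
     = E_rows (\<lambda>rs. \<Sum>j<d. 1 * (err y j + (- \<alpha>) / R * (\<Sum>r\<leftarrow>rs. A $$ (r, j) * (\<gamma> r / row_prob A r)))\<^sup>2)"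
    by (intro expectation_cong_pmf) (simp add: err_fold_update_entry[OF assms])
  also have "\<dots> \<le> (\<Sum>j<d. 1 * (err y j + (- \<alpha>) * measure_pmf.expectation (row_pmf A)
          (\<lambda>r. A $$ (r, j) * (\<gamma> r / row_prob A r)))\<^sup>2)
      + (- \<alpha>)\<^sup>2 / R * measure_pmf.expectation (row_pmf A)
          (\<lambda>r. \<Sum>j<d. 1 * (A $$ (r, j) * (\<gamma> r / row_prob A r))\<^sup>2)"
    by (intro expectation_replicate_weighted_square_le R_pos) auto
  also have "\<dots> = (\<Sum>j<d. (err y j - \<alpha> * mtv \<gamma> j)\<^sup>2)
      + \<alpha>\<^sup>2 / R * measure_pmf.expectation (row_pmf A)
          (\<lambda>r. (\<Sum>j<d. (A $$ (r, j))\<^sup>2) * (\<gamma> r / row_prob A r)\<^sup>2)"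
    by (simp add: mean_row_entry power_mult_distrib sum_distrib_right del: times_divide_eq_right)
  also have "\<dots> \<le> (\<Sum>j<d. (err y j - \<alpha> * mtv \<gamma> j)\<^sup>2) + \<alpha>\<^sup>2 / R * (F * (\<Sum>i<n. (\<gamma> i)\<^sup>2))"
    by (intro add_left_mono mult_left_mono second_moment_row_sample) (auto simp: sum_row_square)
  finally show ?thesis .
qed

lemma rows_wnorm:
  assumes "dim_vec y = n"
  shows "E_rows (\<lambda>rs. wnorm (fold (update_entry A \<alpha> R \<gamma>) rs y))
       \<le> (\<Sum>i<n. (\<Sum>j<d. (A $$ (i, j))\<^sup>2) * (y $ i - \<alpha> * \<gamma> i)\<^sup>2) + \<alpha>\<^sup>2 / R * (F * (\<Sum>i<n. (\<gamma> i)\<^sup>2))"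
proof -
  define w where "w i = (\<Sum>j<d. (A $$ (i, j))\<^sup>2)" for i
  define f where "f i r = (if r = i then 1 else 0) * (\<gamma> r / row_prob A r)" for i r :: nat
  have w_nonneg: "0 \<le> w i" for i by (simp add: w_def sum_nonneg)
  \<comment> \<open>If row \<open>i\<close> has probability zero, the sampled coordinate has mean 0
    rather than \<open>\<gamma> i\<close>, but then its weight \<open>w i\<close> is zero as
    well.\<close>
  have mean: "w i * (y $ i - \<alpha> * measure_pmf.expectation (row_pmf A) (f i))\<^sup>2
      = w i * (y $ i - \<alpha> * \<gamma> i)\<^sup>2" if i: "i < n" for i
  proof (cases "row_prob A i = 0")
    case True
    then show ?thesis using i by (simp add: w_def sum_row_square)
  next
    case False
    have "measure_pmf.expectation (row_pmf A) (f i) = (\<Sum>r<n. if r = i then row_prob A r * (\<gamma> r / row_prob A r) else 0)"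
      unfolding expectation_row_pmf f_def by (intro sum.cong) auto
    also have "\<dots> = \<gamma> i" using i False by simp
    finally show ?thesis by simp
  qed
  have sec: "(\<Sum>i<n. w i * (f i r)\<^sup>2) = (if r < n then w r else 0) * (\<gamma> r / row_prob A r)\<^sup>2" for r
  proof -
    have "(\<Sum>i<n. w i * (f i r)\<^sup>2) = (\<Sum>i<n. if i = r then w r * (\<gamma> r / row_prob A r)\<^sup>2 else 0)"
      by (intro sum.cong) (auto simp: f_def)
    then show ?thesis by simp
  qed
  have f_eq: "(\<lambda>r. if r = i then \<gamma> r / row_prob A r else 0) = f i" for i
    by (auto simp: f_def)
  have "E_rows (\<lambda>rs. wnorm (fold (update_entry A \<alpha> R \<gamma>) rs y))
     = E_rows (\<lambda>rs. \<Sum>i<n. w i * (y $ i + (- \<alpha>) / R * (\<Sum>r\<leftarrow>rs. f i r))\<^sup>2)"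
    unfolding wnorm_def w_def using assms
    by (intro expectation_cong_pmf sum.cong refl) (simp add: fold_update_entry_nth f_eq)
  also have "\<dots> \<le> (\<Sum>i<n. w i * (y $ i + (- \<alpha>) * measure_pmf.expectation (row_pmf A) (f i))\<^sup>2)
      + (- \<alpha>)\<^sup>2 / R * measure_pmf.expectation (row_pmf A) (\<lambda>r. \<Sum>i<n. w i * (f i r)\<^sup>2)"
    by (intro expectation_replicate_weighted_square_le R_pos w_nonneg) auto
  also have "\<dots> = (\<Sum>i<n. w i * (y $ i - \<alpha> * \<gamma> i)\<^sup>2)
      + \<alpha>\<^sup>2 / R * measure_pmf.expectation (row_pmf A) (\<lambda>r. (if r < n then w r else 0) * (\<gamma> r / row_prob A r)\<^sup>2)"
    by (simp add: mean sec)
  also have "\<dots> \<le> (\<Sum>i<n. w i * (y $ i - \<alpha> * \<gamma> i)\<^sup>2) + \<alpha>\<^sup>2 / R * (F * (\<Sum>i<n. (\<gamma> i)\<^sup>2))"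
    by (intro add_left_mono mult_left_mono second_moment_row_sample) (auto simp: w_def sum_row_square)
  finally show ?thesis by (simp add: w_def)
qed

text \<open>Linear functionals average out the sampling noise, so equality holds; this feeds the
  computation of the mean error.\<close>

lemma rows_linear:
  assumes "dim_vec y = n"
  shows "E_rows (\<lambda>rs. \<Sum>j<d. w j * err (fold (update_entry A \<alpha> R \<gamma>) rs y) j)
       = (\<Sum>j<d. w j * (err y j - \<alpha> * mtv \<gamma> j))"
proof -
  have "E_rows (\<lambda>rs. \<Sum>j<d. w j * err (fold (update_entry A \<alpha> R \<gamma>) rs y) j)
     = E_rows (\<lambda>rs. \<Sum>j<d. w j * (err y j + (- \<alpha>) / R * (\<Sum>r\<leftarrow>rs. A $$ (r, j) * (\<gamma> r / row_prob A r))))"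
    by (intro expectation_cong_pmf) (simp add: err_fold_update_entry[OF assms])
  also have "\<dots> = (\<Sum>j<d. w j * E_rows (\<lambda>rs. err y j + (- \<alpha>) / R * (\<Sum>r\<leftarrow>rs. A $$ (r, j) * (\<gamma> r / row_prob A r))))"
    by (subst Bochner_Integration.integral_sum) (auto intro!: integrable_measure_pmf_finite)
  also have "\<dots> = (\<Sum>j<d. w j * (err y j - \<alpha> * mtv \<gamma> j))"
    by (intro sum.cong refl, subst expectation_replicate_affine[OF _ R_pos]) (auto simp: mean_row_entry simp del: times_divide_eq_right)
  finally show ?thesis .
qed

section \<open>Averages over the column draws\<close>

lemma mtv_gamma_est:
  "mtv (gamma_est A b C \<beta> cs) j = - mtv (\<lambda>i. b $ i) j
     + 1 / C * (\<Sum>c\<leftarrow>cs. mtv (\<lambda>r. A $$ (r, c)) j * (inverse (col_prob A c) * \<beta> c))"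
proof -
  have "mtv (\<lambda>r. \<Sum>c\<leftarrow>cs. inverse (col_prob A c) * A $$ (r, c) * \<beta> c) j
      = (\<Sum>c\<leftarrow>cs. mtv (\<lambda>r. A $$ (r, c)) j * (inverse (col_prob A c) * \<beta> c))"
    by (induction cs) (auto simp: mtv_def algebra_simps sum.distrib sum_distrib_left)
  then show ?thesis
    unfolding gamma_est_def[abs_def] mtv_diff mtv_scale by simp
qed

lemma mean_col_entry:
  assumes "i < n"
  shows "measure_pmf.expectation (col_pmf A) (\<lambda>c. A $$ (i, c) * (inverse (col_prob A c) * \<beta> c)) = mv \<beta> i"
proof -
  have "measure_pmf.expectation (col_pmf A) (\<lambda>c. inverse (col_prob A c) * (A $$ (i, c) * \<beta> c)) = mv \<beta> i"
    unfolding mv_def by (rule mean_col_sample) (use assms in \<open>auto dest: col_prob_0D\<close>)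
  then show ?thesis by (simp add: mult.left_commute)
qed

lemma mean_col_gram:
  "measure_pmf.expectation (col_pmf A) (\<lambda>c. mtv (\<lambda>r. A $$ (r, c)) j * (inverse (col_prob A c) * \<beta> c))
     = mtv (mv \<beta>) j"
proof -
  have "measure_pmf.expectation (col_pmf A)
          (\<lambda>c. inverse (col_prob A c) * (mtv (\<lambda>r. A $$ (r, c)) j * \<beta> c))
      = (\<Sum>c<d. mtv (\<lambda>r. A $$ (r, c)) j * \<beta> c)"
    by (rule mean_col_sample) (simp add: mtv_def col_prob_0D)
  also have "\<dots> = mtv (mv \<beta>) j"
    unfolding mv_def mtv_def sum_distrib_left sum_distrib_right
    by (subst sum.swap) (simp add: algebra_simps)
  finally show ?thesis by (simp add: mult.left_commute)
qed

text \<open>Because \<open>b\<close> is \<open>A\<close> applied to \<open>xs\<close>, the full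
  gradient depends on the iterate only through its error.\<close>

lemma gradient_eq: "mtv (mv (beta A y)) j - mtv (\<lambda>i. b $ i) j = mtv (mv (err y)) j"
  unfolding mtv_diff[symmetric] by (rule mtv_cong) (rule residual_eq)

lemma cols_gamma:
  "E_cols (\<lambda>cs. \<Sum>i<n. (gamma_est A b C (beta A y) cs i)\<^sup>2)
     \<le> (\<Sum>i<n. (mv (err y) i)\<^sup>2) + F / C * (\<Sum>j<d. (beta A y j)\<^sup>2)"
proof -
  have "E_cols (\<lambda>cs. \<Sum>i<n. (gamma_est A b C (beta A y) cs i)\<^sup>2)
     = E_cols (\<lambda>cs. \<Sum>i<n. 1 * (- (b $ i) + 1 / C *
         (\<Sum>c\<leftarrow>cs. A $$ (i, c) * (inverse (col_prob A c) * beta A y c)))\<^sup>2)"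
    by (simp add: gamma_est_def ac_simps)
  also have "\<dots> \<le> (\<Sum>i<n. 1 * (- (b $ i) + 1 * measure_pmf.expectation (col_pmf A)
          (\<lambda>c. A $$ (i, c) * (inverse (col_prob A c) * beta A y c)))\<^sup>2)
      + 1\<^sup>2 / C * measure_pmf.expectation (col_pmf A)
          (\<lambda>c. \<Sum>i<n. 1 * (A $$ (i, c) * (inverse (col_prob A c) * beta A y c))\<^sup>2)"
    by (intro expectation_replicate_weighted_square_le C_pos) auto
  also have "\<dots> = (\<Sum>i<n. (mv (err y) i)\<^sup>2)
      + 1 / C * measure_pmf.expectation (col_pmf A)
          (\<lambda>c. (\<Sum>i<n. (A $$ (i, c))\<^sup>2) * (inverse (col_prob A c) * beta A y c)\<^sup>2)"
    by (simp add: mean_col_entry power_mult_distrib sum_distrib_right residual_eq[symmetric])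
  also have "\<dots> \<le> (\<Sum>i<n. (mv (err y) i)\<^sup>2) + 1 / C * (1 * F * (\<Sum>j<d. (beta A y j)\<^sup>2))"
    by (intro add_left_mono mult_left_mono second_moment_col_sample) (auto simp: sum_col_square)
  finally show ?thesis by simp
qed

text \<open>The random part is an average of scaled columns of the Gram matrix of \<open>A\<close>.
  The squared norm of such a column is at most \<open>\<sigma>\<close> times that of the column of
  \<open>A\<close>, hence the extra \<open>\<sigma>\<close> compared with
  \<open>cols_gamma\<close>.\<close>

lemma cols_gradient:
  "E_cols (\<lambda>cs. \<Sum>j<d. (err y j - \<alpha> * mtv (gamma_est A b C (beta A y) cs) j)\<^sup>2)
     \<le> (\<Sum>j<d. (err y j - \<alpha> * mtv (mv (err y)) j)\<^sup>2) + \<alpha>\<^sup>2 * \<sigma> * F / C * (\<Sum>j<d. (beta A y j)\<^sup>2)"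
proof -
  let ?f = "\<lambda>j c. mtv (\<lambda>r. A $$ (r, c)) j * (inverse (col_prob A c) * beta A y c)"
  have "E_cols (\<lambda>cs. \<Sum>j<d. (err y j - \<alpha> * mtv (gamma_est A b C (beta A y) cs) j)\<^sup>2)
     = E_cols (\<lambda>cs. \<Sum>j<d. 1 * (err y j + \<alpha> * mtv (\<lambda>i. b $ i) j + (- \<alpha>) / C * (\<Sum>c\<leftarrow>cs. ?f j c))\<^sup>2)"
    unfolding mtv_gamma_est by (simp add: algebra_simps)
  also have "\<dots> \<le> (\<Sum>j<d. 1 * (err y j + \<alpha> * mtv (\<lambda>i. b $ i) j
          + (- \<alpha>) * measure_pmf.expectation (col_pmf A) (?f j))\<^sup>2)
      + (- \<alpha>)\<^sup>2 / C * measure_pmf.expectation (col_pmf A) (\<lambda>c. \<Sum>j<d. 1 * (?f j c)\<^sup>2)"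
    by (intro expectation_replicate_weighted_square_le C_pos) auto
  also have "\<dots> = (\<Sum>j<d. (err y j - \<alpha> * mtv (mv (err y)) j)\<^sup>2)
      + \<alpha>\<^sup>2 / C * measure_pmf.expectation (col_pmf A)
          (\<lambda>c. (\<Sum>j<d. (mtv (\<lambda>r. A $$ (r, c)) j)\<^sup>2) * (inverse (col_prob A c) * beta A y c)\<^sup>2)"
    unfolding mean_col_gram gradient_eq[symmetric] power_mult_distrib sum_distrib_right
    by (simp add: right_diff_distrib diff_diff_eq2 add.commute add_diff_eq)
  also have "\<dots> \<le> (\<Sum>j<d. (err y j - \<alpha> * mtv (mv (err y)) j)\<^sup>2)
      + \<alpha>\<^sup>2 / C * (\<sigma> * F * (\<Sum>j<d. (beta A y j)\<^sup>2))"
  proof (intro add_left_mono mult_left_mono second_moment_col_sample)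
    fix c assume "c < d"
    then show "(\<Sum>j<d. (mtv (\<lambda>r. A $$ (r, c)) j)\<^sup>2) \<le> \<sigma> * (col_prob A c * F)"
      using op_norm_mtv[of "\<lambda>r. A $$ (r, c)"] by (simp add: sum_col_square)
  qed (use \<sigma>_pos in auto)
  finally show ?thesis by simp
qed

lemma cols_linear:
  "E_cols (\<lambda>cs. \<Sum>j<d. w j * (err y j - \<alpha> * mtv (gamma_est A b C (beta A y) cs) j))
     = (\<Sum>j<d. w j * (err y j - \<alpha> * mtv (mv (err y)) j))"
proof -
  let ?f = "\<lambda>j c. mtv (\<lambda>r. A $$ (r, c)) j * (inverse (col_prob A c) * beta A y c)"
  have "E_cols (\<lambda>cs. \<Sum>j<d. w j * (err y j - \<alpha> * mtv (gamma_est A b C (beta A y) cs) j))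
     = E_cols (\<lambda>cs. \<Sum>j<d. w j * (err y j + \<alpha> * mtv (\<lambda>i. b $ i) j + (- \<alpha>) / C * (\<Sum>c\<leftarrow>cs. ?f j c)))"
    unfolding mtv_gamma_est by (simp add: algebra_simps)
  also have "\<dots> = (\<Sum>j<d. w j * E_cols (\<lambda>cs. err y j + \<alpha> * mtv (\<lambda>i. b $ i) j + (- \<alpha>) / C * (\<Sum>c\<leftarrow>cs. ?f j c)))"
    by (subst Bochner_Integration.integral_sum) (auto intro!: integrable_measure_pmf_finite)
  also have "\<dots> = (\<Sum>j<d. w j * (err y j - \<alpha> * mtv (mv (err y)) j))"
    unfolding gradient_eq[symmetric]
    by (intro sum.cong refl, subst expectation_replicate_affine[OF _ C_pos])
       (auto simp: mean_col_gram ring_distribs)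
  finally show ?thesis .
qed

end

section \<open>Moments of the iterates\<close>

text \<open>Young's inequality. With \<open>K\<close> the number of steps, the factor
  \<open>1 + 1 / K\<close> compounds to at most 3; the final estimate of \<open>sol2\<close> takes
  19 for \<open>K\<close>.\<close>

lemma square_diff_le:
  fixes a c K :: real
  assumes "K > 0"
  shows "(a - c)\<^sup>2 \<le> (1 + 1 / K) * a\<^sup>2 + (1 + K) * c\<^sup>2"
proof -
  have "0 \<le> (a + K * c)\<^sup>2 / K" using assms by simp
  also have "\<dots> = (1 + 1 / K) * a\<^sup>2 + (1 + K) * c\<^sup>2 - (a - c)\<^sup>2"
    using assms by (simp add: field_simps power2_eq_square)
  finally show ?thesis by simp
qed

context sampled_system
begin

section \<open>Support and expectation along the run\<close>

lemma expectation_algo_step: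
  fixes g :: "real Matrix.vec \<Rightarrow> real"
  shows "measure_pmf.expectation (algo_step A b \<alpha> R C y) g
    = E_cols (\<lambda>cs. E_rows (\<lambda>rs. g (fold (update_entry A \<alpha> R (gamma_est A b C (beta A y) cs)) rs y)))"
  unfolding algo_step_def by (simp add: expectation_bind_finite)

lemma finite_set_algo_step [simp]: "finite (set_pmf (algo_step A b \<alpha> R C y))"
  by (simp add: algo_step_def)

lemma set_algo_step:
  assumes "y' \<in> set_pmf (algo_step A b \<alpha> R C y)"
  shows "dim_vec y' = dim_vec y" "nnz y' \<le> nnz y + R"
proof -
  obtain cs rs where rs: "rs \<in> set_pmf (replicate_pmf R (row_pmf A))"
    and y': "y' = fold (update_entry A \<alpha> R (gamma_est A b C (beta A y) cs)) rs y"
    using assms by (auto simp: algo_step_def)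
  show "dim_vec y' = dim_vec y" by (simp add: y')
  have "length rs = R" using rs by (simp add: set_replicate_pmf)
  then show "nnz y' \<le> nnz y + R"
    using nnz_fold_update_entry[of A \<alpha> R "gamma_est A b C (beta A y) cs" rs y] by (simp add: y')
qed

lemma finite_set_algo [simp]: "finite (set_pmf (algo A b \<alpha> R C k))"
  by (induction k) auto

lemma set_algo:
  assumes "y \<in> set_pmf (algo A b \<alpha> R C k)"
  shows "dim_vec y = n \<and> nnz y \<le> R * k"
  using assms
proof (induction k arbitrary: y)
  case 0
  then show ?case by (auto simp: nnz_def)
next
  case (Suc k)
  then obtain z where "z \<in> set_pmf (algo A b \<alpha> R C k)" "y \<in> set_pmf (algo_step A b \<alpha> R C z)"
    by auto
  then show ?case using Suc.IH[of z] set_algo_step[of y z] by auto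
qed

lemma expectation_algo_Suc:
  fixes g :: "real Matrix.vec \<Rightarrow> real"
  shows "measure_pmf.expectation (algo A b \<alpha> R C (Suc k)) g
    = measure_pmf.expectation (algo A b \<alpha> R C k) (\<lambda>y. measure_pmf.expectation (algo_step A b \<alpha> R C y) g)"
  by (simp add: expectation_bind_finite)

section \<open>One-step bounds for the error and the weighted norm\<close>

definition err2 :: "real Matrix.vec \<Rightarrow> real" where "err2 y = (\<Sum>j<d. (err y j)\<^sup>2)"
definition sol2 :: "real Matrix.vec \<Rightarrow> real" where "sol2 y = (\<Sum>j<d. (beta A y j)\<^sup>2)"
definition X :: real where "X = (\<Sum>j<d. (xs j)\<^sup>2)"
definition res2 :: "real Matrix.vec \<Rightarrow> real" where "res2 y = (\<Sum>i<n. (mv (err y) i)\<^sup>2)"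

lemma err2_nonneg: "0 \<le> err2 y" and sol2_nonneg: "0 \<le> sol2 y" and X_nonneg: "0 \<le> X"
  and res2_nonneg: "0 \<le> res2 y" and wnorm_nonneg: "0 \<le> wnorm y"
  by (auto simp: err2_def sol2_def X_def res2_def wnorm_def intro!: sum_nonneg mult_nonneg_nonneg)

text \<open>Turns the decrease by the squared residual into a contraction of the error at rate
  \<open>u\<close>.\<close>

lemma res2_ge: "u * err2 y \<le> \<alpha> * res2 y"
proof -
  have "u * err2 y = (\<alpha> * \<sigma>) * (u * err2 y)" by (simp add: \<alpha>\<sigma>)
  also have "\<dots> = \<alpha> * (u * \<sigma> * err2 y)" by (simp add: ac_simps)
  also have "\<dots> \<le> \<alpha> * res2 y"
    unfolding err2_def res2_def using \<alpha>_pos by (intro mult_left_mono lower_err) simp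
  finally show ?thesis .
qed

text \<open>The left side of \<open>gradient_step_le\<close> is a sum of squares.\<close>

lemma res2_le: "\<alpha> * res2 y \<le> err2 y"
proof -
  have "0 \<le> (\<Sum>j<d. (err y j - \<alpha> * mtv (mv (err y)) j)\<^sup>2)" by (intro sum_nonneg) simp
  then show ?thesis using gradient_step_le[of "err y"] by (simp add: err2_def res2_def)
qed

text \<open>\<open>R\<close> is just large enough for the row noise to consume at most half of the
  decrease \<open>\<alpha> * res2 y\<close>.\<close>

lemma row_noise_le: "\<alpha>\<^sup>2 / R * F \<le> \<alpha> / 2"
proof -
  have "\<alpha>\<^sup>2 / R * F = \<alpha>\<^sup>2 * (F / R)" by simp
  also have "\<dots> \<le> \<alpha>\<^sup>2 * (\<sigma> / 2)"
    using R_ge R_pos by (intro mult_left_mono) (auto simp: field_simps)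
  also have "\<dots> = \<alpha> / 2" using \<alpha>\<sigma> by (simp add: power2_eq_square)
  finally show ?thesis .
qed

lemma col_noise_le: "\<alpha> * (F / C) \<le> u / 160"
proof -
  have "\<alpha> * (F / C) \<le> \<alpha> * (u * \<sigma> / 160)"
    using C_ge C_pos \<alpha>_pos by (intro mult_left_mono) (auto simp: field_simps)
  also have "\<dots> = u / 160" using \<alpha>\<sigma> by simp
  finally show ?thesis .
qed

text \<open>The constant 3/320 is 3/2 times 1/160: column noise enters once through the gradient and
  again, at half weight, through the row noise.\<close>

lemma step_err2:
  assumes y: "dim_vec y = n"
  shows "measure_pmf.expectation (algo_step A b \<alpha> R C y) err2
       \<le> (1 - u / 2) * err2 y + 3 / 320 * u * sol2 y"
proof -
  let ?\<gamma> = "gamma_est A b C (beta A y)"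
  let ?g = "\<lambda>cs. \<Sum>i<n. (?\<gamma> cs i)\<^sup>2"
  have "measure_pmf.expectation (algo_step A b \<alpha> R C y) err2
     \<le> E_cols (\<lambda>cs. (\<Sum>j<d. (err y j - \<alpha> * mtv (?\<gamma> cs) j)\<^sup>2) + \<alpha>\<^sup>2 / R * (F * ?g cs))"
    unfolding expectation_algo_step err2_def
    by (intro expectation_mono_finite rows_err y) simp
  also have "\<dots> = E_cols (\<lambda>cs. \<Sum>j<d. (err y j - \<alpha> * mtv (?\<gamma> cs) j)\<^sup>2) + \<alpha>\<^sup>2 / R * (F * E_cols ?g)"
    by (subst Bochner_Integration.integral_add) (auto intro!: integrable_measure_pmf_finite)
  also have "\<dots> \<le> (err2 y - \<alpha> * res2 y + \<alpha>\<^sup>2 * \<sigma> * F / C * sol2 y)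
      + \<alpha>\<^sup>2 / R * (F * (res2 y + F / C * sol2 y))"
  proof (intro add_mono mult_left_mono)
    show "E_cols (\<lambda>cs. \<Sum>j<d. (err y j - \<alpha> * mtv (?\<gamma> cs) j)\<^sup>2)
       \<le> err2 y - \<alpha> * res2 y + \<alpha>\<^sup>2 * \<sigma> * F / C * sol2 y"
      using cols_gradient[of y] gradient_step_le[of "err y"]
      by (simp add: err2_def res2_def sol2_def)
    show "E_cols ?g \<le> res2 y + F / C * sol2 y"
      using cols_gamma[of y] by (simp add: res2_def sol2_def)
  qed (use F_pos in auto)
  also have "\<alpha>\<^sup>2 * \<sigma> * F / C * sol2 y = \<alpha> * (F / C) * sol2 y"
    using \<alpha>\<sigma> by (simp add: power2_eq_square)
  also have "\<alpha>\<^sup>2 / R * (F * (res2 y + F / C * sol2 y)) \<le> \<alpha> / 2 * (res2 y + F / C * sol2 y)"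
    unfolding mult.assoc[symmetric]
    using F_pos res2_nonneg sol2_nonneg by (intro mult_right_mono row_noise_le) auto
  also have "err2 y - \<alpha> * res2 y + \<alpha> * (F / C) * sol2 y + \<alpha> / 2 * (res2 y + F / C * sol2 y)
      = err2 y - \<alpha> * res2 y / 2 + 3 / 2 * (\<alpha> * (F / C) * sol2 y)"
    by (simp add: algebra_simps)
  also have "\<dots> \<le> err2 y - u * err2 y / 2 + 3 / 2 * (u / 160 * sol2 y)"
    by (intro add_mono diff_mono divide_right_mono mult_left_mono mult_right_mono
        res2_ge col_noise_le sol2_nonneg) auto
  finally show ?thesis by (simp add: algebra_simps)
qed

lemma step_wnorm:
  assumes y: "dim_vec y = n" and K: "K > 0"
  shows "measure_pmf.expectation (algo_step A b \<alpha> R C y) wnorm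
       \<le> (1 + 1 / K) * wnorm y + 3 / 2 * (1 + K) * (err2 y + u / 160 * sol2 y)"
proof -
  let ?\<gamma> = "gamma_est A b C (beta A y)"
  let ?g = "\<lambda>cs. \<Sum>i<n. (?\<gamma> cs i)\<^sup>2"
  let ?w = "\<lambda>i. \<Sum>j<d. (A $$ (i, j))\<^sup>2"
  have rows: "E_rows (\<lambda>rs. wnorm (fold (update_entry A \<alpha> R (?\<gamma> cs)) rs y))
      \<le> (1 + 1 / K) * wnorm y + 3 / 2 * (1 + K) * \<alpha> * ?g cs" for cs
  proof -
    have "(\<Sum>i<n. ?w i * (y $ i - \<alpha> * ?\<gamma> cs i)\<^sup>2)
        \<le> (\<Sum>i<n. ?w i * ((1 + 1 / K) * (y $ i)\<^sup>2 + (1 + K) * (\<alpha> * ?\<gamma> cs i)\<^sup>2))"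
      by (intro sum_mono mult_left_mono square_diff_le K sum_nonneg) simp
    also have "\<dots> = (1 + 1 / K) * wnorm y + (1 + K) * \<alpha>\<^sup>2 * (\<Sum>i<n. ?w i * (?\<gamma> cs i)\<^sup>2)"
      by (simp only: wnorm_def sum_distrib_left sum.distrib[symmetric])
         (intro sum.cong, auto simp: algebra_simps power_mult_distrib)
    also have "\<dots> \<le> (1 + 1 / K) * wnorm y + (1 + K) * \<alpha>\<^sup>2 * (\<sigma> * ?g cs)"
      unfolding sum_distrib_left[of \<sigma>]
      using K by (intro add_left_mono mult_left_mono sum_mono mult_right_mono row_le) auto
    also have "(1 + K) * \<alpha>\<^sup>2 * (\<sigma> * ?g cs) = (1 + K) * \<alpha> * (\<alpha> * \<sigma>) * ?g cs"
      by (simp add: power2_eq_square)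
    finally have 1: "(\<Sum>i<n. ?w i * (y $ i - \<alpha> * ?\<gamma> cs i)\<^sup>2)
        \<le> (1 + 1 / K) * wnorm y + (1 + K) * \<alpha> * ?g cs"
      by (simp add: \<alpha>\<sigma>)
    have g: "0 \<le> ?g cs" by (intro sum_nonneg) simp
    have 2: "\<alpha>\<^sup>2 / R * (F * ?g cs) \<le> \<alpha> / 2 * ?g cs"
      unfolding mult.assoc[symmetric] using g by (intro mult_right_mono row_noise_le)
    \<comment> \<open>Inflating the row noise by \<open>1 + K\<close> lets it join the main term
      under the common factor 3/2.\<close>
    have 3: "\<alpha> / 2 * ?g cs \<le> (1 + K) * \<alpha> / 2 * ?g cs"
      using K \<alpha>_pos g by (intro mult_right_mono) auto
    have 4: "3 / 2 * (1 + K) * \<alpha> * ?g cs = (1 + K) * \<alpha> * ?g cs + (1 + K) * \<alpha> / 2 * ?g cs"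
      by (simp add: field_simps)
    show ?thesis
      unfolding 4 using rows_wnorm[OF y, of "?\<gamma> cs"] add_mono[OF 1 order_trans[OF 2 3]]
      by (simp only: add.assoc[symmetric])
  qed
  have "measure_pmf.expectation (algo_step A b \<alpha> R C y) wnorm
     \<le> E_cols (\<lambda>cs. (1 + 1 / K) * wnorm y + 3 / 2 * (1 + K) * \<alpha> * ?g cs)"
    unfolding expectation_algo_step by (intro expectation_mono_finite rows) simp
  also have "\<dots> = (1 + 1 / K) * wnorm y + 3 / 2 * (1 + K) * (\<alpha> * E_cols ?g)"
    by (subst Bochner_Integration.integral_add) (auto intro!: integrable_measure_pmf_finite)
  also have "\<alpha> * E_cols ?g \<le> err2 y + u / 160 * sol2 y"
  proof -
    have "\<alpha> * E_cols ?g \<le> \<alpha> * (res2 y + F / C * sol2 y)"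
      using cols_gamma[of y] \<alpha>_pos by (intro mult_left_mono) (auto simp: res2_def sol2_def)
    also have "\<dots> = \<alpha> * res2 y + \<alpha> * (F / C) * sol2 y" by (simp add: algebra_simps)
    also have "\<dots> \<le> err2 y + u / 160 * sol2 y"
      by (intro add_mono res2_le mult_right_mono col_noise_le sol2_nonneg)
    finally show ?thesis .
  qed
  finally show ?thesis using K by (simp add: mult_left_mono)
qed

section \<open>The mean iteration\<close>

definition G :: "(nat \<Rightarrow> real) \<Rightarrow> nat \<Rightarrow> real" where "G w j = w j - \<alpha> * mtv (mv w) j"

lemma G_inner: "(\<Sum>j<d. G w j * v j) = (\<Sum>j<d. w j * v j) - \<alpha> * (\<Sum>i<n. mv w i * mv v i)"
  using adjoint[of "mv w" v]
  by (simp add: G_def left_diff_distrib sum_subtractf sum_distrib_left[symmetric] mult.assoc)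

lemma G_symmetric: "(\<Sum>j<d. G w j * v j) = (\<Sum>j<d. w j * G v j)"
  using G_inner[of w v] G_inner[of v w] by (simp add: mult.commute)

lemma G_funpow_symmetric: "(\<Sum>j<d. (G ^^ k) w j * v j) = (\<Sum>j<d. w j * (G ^^ k) v j)"
proof (induction k arbitrary: v)
  case (Suc k)
  have "(\<Sum>j<d. (G ^^ Suc k) w j * v j) = (\<Sum>j<d. (G ^^ k) w j * G v j)"
    by (simp add: G_symmetric)
  also have "\<dots> = (\<Sum>j<d. w j * (G ^^ Suc k) v j)"
    unfolding Suc.IH by (simp add: funpow_swap1)
  finally show ?case .
qed simp

text \<open>As \<open>0 \<le> G \<le> 1\<close>, all powers of \<open>G\<close> are positive semidefinite; odd powers reduce to \<open>G\<close> itself.\<close>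

lemma G_funpow_nonneg: "0 \<le> (\<Sum>j<d. (G ^^ k) w j * w j)"
proof (cases "even k")
  case True
  then obtain m where "k = m + m" by (metis evenE mult_2)
  then have "(\<Sum>j<d. (G ^^ k) w j * w j) = (\<Sum>j<d. (G ^^ m) w j * (G ^^ m) w j)"
    by (simp add: funpow_add G_funpow_symmetric)
  then show ?thesis by (simp add: sum_nonneg)
next
  case False
  then obtain m where k: "k = m + Suc m" by (metis oddE mult_2 add_Suc_right Suc_eq_plus1)
  have "(\<Sum>j<d. (G ^^ k) w j * w j) = (\<Sum>j<d. G ((G ^^ m) w) j * (G ^^ m) w j)"
    unfolding k funpow_add o_apply by (subst G_funpow_symmetric) simp
  also have "\<dots> = (\<Sum>j<d. ((G ^^ m) w j)\<^sup>2) - \<alpha> * (\<Sum>i<n. (mv ((G ^^ m) w) i)\<^sup>2)"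
    by (simp add: G_inner power2_eq_square)
  also have "\<dots> \<ge> (\<Sum>j<d. ((G ^^ m) w j - \<alpha> * mtv (mv ((G ^^ m) w)) j)\<^sup>2)"
    by (rule gradient_step_le)
  finally show ?thesis by (rule order_trans[rotated]) (simp add: sum_nonneg)
qed

text \<open>Moving \<open>G\<close> to the test vector keeps the quantity a linear functional of the
  error, so that the step can be iterated.\<close>

lemma step_linear:
  assumes y: "dim_vec y = n"
  shows "measure_pmf.expectation (algo_step A b \<alpha> R C y) (\<lambda>y'. \<Sum>j<d. w j * err y' j)
       = (\<Sum>j<d. G w j * err y j)"
proof -
  have "measure_pmf.expectation (algo_step A b \<alpha> R C y) (\<lambda>y'. \<Sum>j<d. w j * err y' j)
     = (\<Sum>j<d. w j * G (err y) j)"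
    unfolding expectation_algo_step rows_linear[OF y] cols_linear G_def ..
  then show ?thesis by (simp add: G_symmetric)
qed

lemma err_zero: "j < d \<Longrightarrow> err (0\<^sub>v n) j = - xs j" and beta_zero: "beta A (0\<^sub>v n) j = 0"
  by (auto simp: err_def beta_def)

text \<open>Testing against every \<open>w\<close> expresses \<open>E e = - G\<^sup>k xs\<close>
  without vector-valued expectations. The test vector varies in the induction, and the start at zero
  has error \<open>- xs\<close>.\<close>

lemma expectation_err_linear:
  "measure_pmf.expectation (algo A b \<alpha> R C k) (\<lambda>y. \<Sum>j<d. w j * err y j)
     = - (\<Sum>j<d. (G ^^ k) w j * xs j)"
proof (induction k arbitrary: w)
  case 0
  then show ?case by (simp add: err_zero sum_negf)
next
  case (Suc k)
  have "measure_pmf.expectation (algo A b \<alpha> R C (Suc k)) (\<lambda>y. \<Sum>j<d. w j * err y j)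
     = measure_pmf.expectation (algo A b \<alpha> R C k) (\<lambda>y. \<Sum>j<d. G w j * err y j)"
    unfolding expectation_algo_Suc
    by (intro expectation_cong_pmf step_linear) (simp add: set_algo)
  then show ?case by (simp add: Suc.IH funpow_swap1)
qed

lemma sol2_eq: "sol2 y = err2 y + 2 * (\<Sum>j<d. xs j * err y j) + X"
  unfolding sol2_def err2_def X_def sum_distrib_left sum.distrib[symmetric]
  by (intro sum.cong) (auto simp: err_def power2_eq_square algebra_simps)

abbreviation E_algo :: "nat \<Rightarrow> (real Matrix.vec \<Rightarrow> real) \<Rightarrow> real" where
  "E_algo k \<equiv> measure_pmf.expectation (algo A b \<alpha> R C k)"

text \<open>The mean error is \<open>- G\<^sup>k xs\<close>, so it correlates negatively with \<open>xs\<close>.\<close>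

lemma expectation_sol2: "E_algo k sol2 \<le> E_algo k err2 + X"
proof -
  have "E_algo k sol2 = E_algo k err2 + 2 * E_algo k (\<lambda>y. \<Sum>j<d. xs j * err y j) + X"
    unfolding sol2_eq[abs_def]
    by (subst Bochner_Integration.integral_add,
        (auto intro!: integrable_measure_pmf_finite)[2],
        subst Bochner_Integration.integral_add)
       (auto intro!: integrable_measure_pmf_finite)
  then show ?thesis using G_funpow_nonneg[of k xs] by (simp add: expectation_err_linear)
qed

section \<open>Moments after all steps\<close>

lemma expectation_err2_Suc:
  "E_algo (Suc k) err2 \<le> (1 - 157 / 320 * u) * E_algo k err2 + 3 / 320 * u * X"
proof -
  have "E_algo (Suc k) err2 \<le> E_algo k (\<lambda>y. (1 - u / 2) * err2 y + 3 / 320 * u * sol2 y)"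
    unfolding expectation_algo_Suc
    by (intro expectation_mono_finite step_err2) (auto simp: set_algo)
  also have "\<dots> = (1 - u / 2) * E_algo k err2 + 3 / 320 * u * E_algo k sol2"
    by (subst Bochner_Integration.integral_add) (auto intro!: integrable_measure_pmf_finite)
  \<comment> \<open>Trading the mean of \<open>sol2\<close> for that of \<open>err2\<close> plus
    \<open>X\<close> costs 3/320 of the rate: 1/2 - 3/320 = 157/320.\<close>
  also have "\<dots> \<le> (1 - u / 2) * E_algo k err2 + 3 / 320 * u * (E_algo k err2 + X)"
    using u_pos by (intro add_left_mono mult_left_mono expectation_sol2) auto
  finally show ?thesis by (simp add: algebra_simps)
qed

text \<open>In units of \<open>X\<close>, 3/157 is the fixed point of the recursion, the quotient of
  3/320 by 157/320.\<close>

lemma expectation_err2: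
  "E_algo k err2 \<le> ((1 - 157 / 320 * u) ^ k + 3 / 157) * X"
proof (induction k)
  case 0
  have "err2 (0\<^sub>v n) = X" by (simp add: err2_def X_def err_zero)
  then show ?case using X_nonneg by (simp add: algebra_simps)
next
  case (Suc k)
  have "E_algo (Suc k) err2 \<le> (1 - 157 / 320 * u) * E_algo k err2 + 3 / 320 * u * X"
    by (rule expectation_err2_Suc)
  also have "\<dots> \<le> (1 - 157 / 320 * u) * (((1 - 157 / 320 * u) ^ k + 3 / 157) * X) + 3 / 320 * u * X"
    using u_pos u_le_1 by (intro add_right_mono mult_left_mono Suc.IH) auto
  also have "\<dots> = ((1 - 157 / 320 * u) ^ Suc k + 3 / 157) * X"
    by (simp add: algebra_simps)
  finally show ?case .
qed

lemma expectation_err2_le: "E_algo k err2 \<le> 160 / 157 * X"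
proof -
  have "(1 - 157 / 320 * u) ^ k \<le> 1"
    using u_pos u_le_1 by (intro power_le_one) auto
  then have "((1 - 157 / 320 * u) ^ k + 3 / 157) * X \<le> 160 / 157 * X"
    using X_nonneg by (intro mult_right_mono) auto
  then show ?thesis using expectation_err2[of k] by linarith
qed

lemma expectation_wnorm:
  assumes K: "K > 0"
  shows "E_algo k wnorm \<le> 3 * (1 + K) * k * (1 + 1 / K) ^ k * X"
proof (induction k)
  case 0
  then show ?case by (simp add: wnorm_def)
next
  case (Suc k)
  have "E_algo (Suc k) wnorm
      \<le> E_algo k (\<lambda>y. (1 + 1 / K) * wnorm y + 3 / 2 * (1 + K) * (err2 y + u / 160 * sol2 y))"
    unfolding expectation_algo_Suc
    by (intro expectation_mono_finite step_wnorm K) (auto simp: set_algo)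
  also have "\<dots> = (1 + 1 / K) * E_algo k wnorm + 3 / 2 * (1 + K) * (E_algo k err2 + u / 160 * E_algo k sol2)"
    by (simp add: integrable_measure_pmf_finite)
  \<comment> \<open>The mean of \<open>err2\<close> is at most 160/157 times \<open>X\<close> and
    that of \<open>sol2\<close> at most \<open>X\<close> more, which stays well below
    \<open>2 * X\<close> after the division by 160.\<close>
  also have "\<dots> \<le> (1 + 1 / K) * E_algo k wnorm + 3 / 2 * (1 + K) * (2 * X)"
  proof (intro add_left_mono mult_left_mono)
    have "u / 160 * E_algo k sol2 \<le> 1 / 160 * E_algo k sol2"
      using u_le_1 sol2_nonneg by (intro mult_right_mono Bochner_Integration.integral_nonneg) auto
    then show "E_algo k err2 + u / 160 * E_algo k sol2 \<le> 2 * X"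
      using expectation_err2_le[of k] expectation_sol2[of k] X_nonneg by linarith
  qed (use K in auto)
  \<comment> \<open>The new summand is multiplied by a power that is at least 1, so that all
    summands share one growth factor.\<close>
  also have "\<dots> \<le> (1 + 1 / K) * (3 * (1 + K) * k * (1 + 1 / K) ^ k * X) + 3 * (1 + K) * (1 + 1 / K) ^ Suc k * X"
  proof (intro add_mono mult_left_mono Suc.IH)
    have "1 \<le> (1 + 1 / K) ^ Suc k" using K by (intro one_le_power) auto
    then have "3 * (1 + K) * X * 1 \<le> 3 * (1 + K) * X * (1 + 1 / K) ^ Suc k"
      using K X_nonneg by (intro mult_left_mono) auto
    then show "3 / 2 * (1 + K) * (2 * X) \<le> 3 * (1 + K) * (1 + 1 / K) ^ Suc k * X"
      by (simp only: ac_simps)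
  qed (use K in auto)
  also have "\<dots> = 3 * (1 + K) * Suc k * (1 + 1 / K) ^ Suc k * X"
    using K by (simp add: algebra_simps add_divide_distrib)
  finally show ?case .
qed

text \<open>At \<open>k = K\<close> the growth factor is at most e, hence at most 3, and
  \<open>1 + K \<le> 2 * K\<close>; thus 18 = 3 * 2 * 3.\<close>

lemma expectation_wnorm_final:
  assumes K: "K > 0"
  shows "E_algo K wnorm \<le> 18 * (real K)\<^sup>2 * X"
proof -
  have "(1 + 1 / real K) ^ K \<le> exp 1"
    using exp_ge_one_plus_x_over_n_power_n[of K 1] K by simp
  then have e: "(1 + 1 / real K) ^ K \<le> 3" using exp_le by linarith
  have "E_algo K wnorm \<le> 3 * (1 + real K) * K * (1 + 1 / real K) ^ K * X"
    using expectation_wnorm[of "real K" K] K by simp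
  also have "\<dots> \<le> 3 * (2 * real K) * K * 3 * X"
    using K e X_nonneg by (intro mult_right_mono mult_mono) auto
  finally show ?thesis by (simp add: power2_eq_square)
qed

lemma expectation_err2_final:
  assumes K: "4 * ln 4 \<le> u * K"
  shows "E_algo K err2 \<le> 867 / 10000 * X"
proof -
  have "(1 - 157 / 320 * u) ^ K \<le> exp (- (157 / 320 * u)) ^ K"
    using u_le_1 exp_ge_add_one_self[of "- (157 / 320 * u)"] by (intro power_mono) auto
  also have "\<dots> = exp (- (157 / 320) * (u * K))"
    by (simp add: exp_of_nat_mult[symmetric] mult.commute mult.left_commute)
  \<comment> \<open>Here 4 * 157/320 = 2 - 3/80; the main part of the exponent yields 1/16.\<close>
  also have "\<dots> \<le> exp (- 2 * ln 4 + 3 / 80 * ln 4)"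
    using K by simp
  also have "\<dots> = exp (3 / 80 * ln 4) / 16"
  proof -
    have "exp (2 * ln (4 :: real)) = 16"
      using exp_of_nat_mult[of 2 "ln (4 :: real)"] by simp
    then have "exp (- 2 * ln (4 :: real)) = 1 / 16" by (simp add: exp_minus field_simps)
    then show ?thesis unfolding exp_add by simp
  qed
  \<comment> \<open>Since \<open>ln 4\<close> is below 2, the surplus exponent is at most 3/40, and
    \<open>exp (- t) \<ge> 1 - t\<close> gives 40/37. Then 40/(37 * 16) + 3/157 is just below
    0.0867.\<close>
  also have "exp (3 / 80 * ln (4 :: real)) \<le> 40 / 37"
  proof -
    have "ln (4 :: real) = 2 * ln 2" using ln_realpow[of 2 2] by simp
    then have l: "3 / 80 * ln (4 :: real) \<le> 3 / 40" using ln_2_less_1 by linarith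
    have "37 / 40 \<le> exp (- (3 / 40 :: real))" using exp_ge_add_one_self[of "- (3 / 40 :: real)"] by simp
    then have "exp (3 / 40 :: real) \<le> 40 / 37" by (simp add: exp_minus field_simps)
    moreover have "exp (3 / 80 * ln (4 :: real)) \<le> exp (3 / 40)" using l by simp
    ultimately show ?thesis by linarith
  qed
  finally have "(1 - 157 / 320 * u) ^ K + 3 / 157 \<le> 867 / 10000" by simp
  then show ?thesis
    using expectation_err2[of K] mult_right_mono[OF _ X_nonneg] by (meson order_trans)
qed

section \<open>From the moments to the bound on \<open>phi\<close>\<close>

lemma sol2_ge:
  assumes "err2 y < 361 / 400 * X"
  shows "X / 400 \<le> sol2 y"
proof -
  have "X = (\<Sum>j<d. (err y j - beta A y j)\<^sup>2)" by (simp add: X_def err_def)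
  \<comment> \<open>The threshold 361/400 is the square of 19/20. Young's inequality with 19 then
    acts as the triangle inequality: 20/19 * 361/400 = 19/20 leaves \<open>X / 20\<close> for the
    term \<open>20 * sol2 y\<close>.\<close>
  also have "\<dots> \<le> (\<Sum>j<d. (1 + 1 / 19) * (err y j)\<^sup>2 + (1 + 19) * (beta A y j)\<^sup>2)"
    by (intro sum_mono square_diff_le) simp
  also have "\<dots> = 20 / 19 * err2 y + 20 * sol2 y"
    by (simp add: err2_def sol2_def sum.distrib sum_distrib_left)
  finally show ?thesis using assms by linarith
qed

lemma vnorm_transpose_mult_square:
  assumes "dim_vec y = n"
  shows "(vnorm (transpose_mat A *\<^sub>v y))\<^sup>2 = sol2 y"
proof -
  have y: "y \<in> carrier_vec n" using assms by (intro carrier_vecI)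
  have At: "transpose_mat A \<in> carrier_mat d n" using A by simp
  have "(transpose_mat A *\<^sub>v y) $ j = beta A y j" if "j < d" for j
    unfolding mult_mat_vec_nth[OF At y that] using that by (simp add: beta_def)
  then show ?thesis
    unfolding vnorm_square sol2_def by (intro sum.cong) auto
qed

text \<open>The extended quotient agrees with the real one when a zero denominator only meets zero
  numerators, since 0 / 0 is 0 in both.\<close>

lemma phi_eq:
  assumes y: "dim_vec y = n" and pos: "0 < sol2 y \<or> wnorm y = 0"
  shows "phi A y = ereal (real (nnz y) * (wnorm y / sol2 y))"
proof -
  let ?t = "\<lambda>r. \<bar>y $ r\<bar>\<^sup>2 * (vnorm (Matrix.row A r))\<^sup>2"
  have sum: "(\<Sum>r<n. ?t r) = wnorm y"
    unfolding wnorm_def by (intro sum.cong) (auto simp: vnorm_row_square[OF A])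
  have summand: "ereal (?t r) / ereal (sol2 y) = ereal (?t r / sol2 y)" if "r < n" for r
  proof (cases "sol2 y = 0")
    case True
    then have "(\<Sum>r<n. ?t r) = 0" using pos sum by simp
    then have "?t r = 0" using that by (subst (asm) sum_nonneg_eq_0_iff) auto
    then show ?thesis by (simp del: mult_eq_0_iff add: zero_ereal_def[symmetric])
  qed simp
  have "(\<Sum>r<n. ereal (?t r) / ereal (sol2 y)) = ereal (wnorm y / sol2 y)"
    using summand by (simp add: sum[symmetric] sum_divide_distrib del: times_ereal.simps)
  then show ?thesis
    by (simp add: phi_def y vnorm_transpose_mult_square)
qed

text \<open>The two failure probabilities, 97/1000 for a small \<open>sol2\<close> and 2/1000 for a
  large \<open>wnorm\<close>, stay below 1/10 together. Outside both events the quotient is at most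
  9000 * 400 = 3600000 times the square of \<open>K\<close>.\<close>

lemma prob_phi_ge:
  assumes K: "4 * ln 4 \<le> u * K"
    and B: "3600000 * real R * real K ^ 3 \<le> B"
  shows "9 / 10 \<le> measure_pmf.prob (algo A b \<alpha> R C K) {y. phi A y \<le> ereal B}"
proof -
  let ?P = "measure_pmf.prob (algo A b \<alpha> R C K)"
  have "0 < u * real K" using K by (smt (verit) ln_gt_zero)
  then have K_pos: "K > 0" using u_pos by (auto simp: zero_less_mult_iff)
  have B_nonneg: "0 \<le> B" using B by (smt (verit) mult_nonneg_nonneg of_nat_0_le_iff zero_le_power)
  show ?thesis
  proof (cases "X = 0")
    \<comment> \<open>The Markov thresholds of the other case would vanish here. Instead
      \<open>wnorm\<close> has mean zero, so \<open>phi\<close> is 0 on the whole support.\<close>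
    case True
    then have "E_algo K wnorm \<le> 0" using expectation_wnorm_final[OF K_pos] by simp
    moreover have "0 \<le> E_algo K wnorm"
      by (intro Bochner_Integration.integral_nonneg wnorm_nonneg)
    ultimately have "E_algo K wnorm = 0" by linarith
    then have "AE y in algo A b \<alpha> R C K. wnorm y = 0"
      using wnorm_nonneg
      by (subst (asm) integral_nonneg_eq_0_iff_AE) (auto intro!: integrable_measure_pmf_finite)
    then have w: "wnorm y = 0" if "y \<in> set_pmf (algo A b \<alpha> R C K)" for y
      using that by (simp add: AE_measure_pmf_iff)
    have "?P {y. phi A y \<le> ereal B} = 1"
    proof (rule measure_pmf.prob_eq_1[THEN iffD2])
      show "AE y in algo A b \<alpha> R C K. y \<in> {y. phi A y \<le> ereal B}"
        unfolding AE_measure_pmf_iff using w B_nonneg by (auto simp: phi_eq set_algo)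
    qed simp
    then show ?thesis by simp
  next
    case False
    then have X_pos: "X > 0" using X_nonneg by simp
    let ?M = "9000 * (real K)\<^sup>2 * X"
    have M_pos: "?M > 0" using X_pos K_pos by simp
    have "?P {y. 361 / 400 * X \<le> err2 y} \<le> 867 / 10000 * X / (361 / 400 * X)"
      using X_pos by (intro markov_pmf_finite expectation_err2_final K err2_nonneg) auto
    also have "\<dots> \<le> 97 / 1000" using X_pos by simp
    finally have bad1: "?P {y. 361 / 400 * X \<le> err2 y} \<le> 97 / 1000" .
    have "?P {y. ?M \<le> wnorm y} \<le> 18 * (real K)\<^sup>2 * X / ?M"
      using M_pos by (intro markov_pmf_finite expectation_wnorm_final K_pos wnorm_nonneg) auto
    also have "\<dots> = 2 / 1000" using X_pos K_pos by (simp add: field_simps)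
    finally have bad2: "?P {y. ?M \<le> wnorm y} \<le> 2 / 1000" .
    have good: "phi A y \<le> ereal B"
      if y: "y \<in> set_pmf (algo A b \<alpha> R C K)" and 1: "err2 y < 361 / 400 * X" and 2: "wnorm y < ?M" for y
    proof -
      have s: "X / 400 \<le> sol2 y" using 1 by (rule sol2_ge)
      then have s_pos: "0 < sol2 y" using X_pos by linarith
      have "wnorm y / sol2 y \<le> ?M / (X / 400)"
        using 2 s X_pos M_pos by (intro frac_le) auto
      also have "\<dots> = 3600000 * (real K)\<^sup>2" using X_pos by simp
      finally have q: "wnorm y / sol2 y \<le> 3600000 * (real K)\<^sup>2" .
      have "nnz y \<le> R * K" using set_algo[OF y] by simp
      then have nz: "real (nnz y) \<le> real R * real K" by (metis of_nat_le_iff of_nat_mult)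
      have "real (nnz y) * (wnorm y / sol2 y) \<le> (real R * real K) * (3600000 * (real K)\<^sup>2)"
        using s_pos wnorm_nonneg by (intro mult_mono nz q) auto
      also have "\<dots> \<le> B" using B by (simp add: power2_eq_square power3_eq_cube ac_simps)
      finally show ?thesis using set_algo[OF y] s_pos by (simp add: phi_eq)
    qed
    have "1 - ?P {y. phi A y \<le> ereal B} = ?P (- {y. phi A y \<le> ereal B})"
      by (subst measure_pmf.prob_compl[symmetric]) (auto simp: Compl_eq_Diff_UNIV)
    also have "\<dots> \<le> ?P ({y. 361 / 400 * X \<le> err2 y} \<union> {y. ?M \<le> wnorm y})"
      using good by (intro measure_pmf.finite_measure_mono_AE) (auto simp: AE_measure_pmf_iff not_le[symmetric])
    also have "\<dots> \<le> ?P {y. 361 / 400 * X \<le> err2 y} + ?P {y. ?M \<le> wnorm y}"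
      by (intro measure_Un_le) auto
    finally show ?thesis using bad1 bad2 by linarith
  qed
qed

end

theorem theorem3:
  shows "\<exists>const :: real. \<forall>(n :: nat) (d :: nat) (A :: real mat) (b :: real Matrix.vec) (\<epsilon> :: real).
    A \<in> carrier_mat n d \<longrightarrow> A \<noteq> 0\<^sub>m n d \<longrightarrow> b \<in> mat_range A \<longrightarrow> 0 < \<epsilon> \<longrightarrow> \<epsilon> < 1 / 4 \<longrightarrow>
    (let \<alpha> = 1 / (spectral_norm A)\<^sup>2;
         R = nat \<lceil>2 * (kappa_F A)\<^sup>2 / (kappa A)\<^sup>2\<rceil>;
         C = nat \<lceil>10 * (kappa_F A)\<^sup>2 / \<epsilon>\<^sup>2\<rceil>;
         K = nat \<lceil>4 * (kappa A)\<^sup>2 * ln (1 / \<epsilon>)\<rceil>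
     in measure_pmf.prob (algo A b \<alpha> R C K)
          {y. phi A y \<le> ereal (const * (kappa_F A)\<^sup>2 * (kappa A) ^ 6 * (ln (1 / \<epsilon>)) ^ 3)}
        \<ge> 9 / 10)"
\<comment> \<open>The constant is 3600000 * 3 * 125, with 3 from the bound on \<open>R\<close> and
  125 the cube of the factor 5 in the bound on \<open>K\<close>.\<close>
proof (intro exI[of _ 1350000000] allI impI, unfold Let_def)
  fix n d :: nat and A :: "real mat" and b :: "real Matrix.vec" and \<epsilon> :: real
  assume A: "A \<in> carrier_mat n d" and nz: "A \<noteq> 0\<^sub>m n d" and b: "b \<in> mat_range A"
    and \<epsilon>: "0 < \<epsilon>" "\<epsilon> < 1 / 4"
  define S T f where "S = spectral_norm A" and "T = spectral_norm (pseudoinverse A)" and "f = frobenius_norm A"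
  define \<kappa> \<phi> L where "\<kappa> = kappa A" and "\<phi> = kappa_F A" and "L = ln (1 / \<epsilon>)"
  define R C K where "R = nat \<lceil>2 * \<phi>\<^sup>2 / \<kappa>\<^sup>2\<rceil>" and "C = nat \<lceil>10 * \<phi>\<^sup>2 / \<epsilon>\<^sup>2\<rceil>"
    and "K = nat \<lceil>4 * \<kappa>\<^sup>2 * L\<rceil>"
  have S: "0 < S" and \<kappa>1: "1 \<le> \<kappa>" using spectral_pos[OF A nz] by (simp_all add: S_def \<kappa>_def)
  have \<kappa>: "\<kappa> = S * T" and \<phi>: "\<phi> = f * T"
    by (simp_all add: \<kappa>_def \<phi>_def kappa_def kappa_F_def S_def T_def f_def)
  have T: "0 < T" using \<kappa>1 S unfolding \<kappa> by (smt (verit) zero_less_mult_pos mult_pos_neg)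
  have Sf: "S \<le> f" unfolding S_def f_def by (rule spectral_norm_le_frobenius)
  have f: "0 < f" using S Sf by simp
  have \<kappa>\<phi>: "\<kappa> \<le> \<phi>" unfolding \<kappa> \<phi> using Sf T by (intro mult_right_mono) auto
  have ratio: "\<phi>\<^sup>2 / \<kappa>\<^sup>2 = f\<^sup>2 / S\<^sup>2" unfolding \<kappa> \<phi> using T by (simp add: power_mult_distrib)
  obtain x0 where x0: "x0 \<in> carrier_vec d" "b = A *\<^sub>v x0" using b A by (auto simp: mat_range_def)
  have bc: "b \<in> carrier_vec n" using A x0 by simp
  define xs where "xs j = (pseudoinverse A *\<^sub>v b) $ j" for j
  \<comment> \<open>From \<open>\<epsilon> < 1 / 4\<close>. This makes \<open>K\<close> large enough
    for the error bound, and \<open>1 \<le> L\<close> lets the rounding in \<open>K\<close> be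
    absorbed.\<close>
  have L4: "ln 4 \<le> L"
    unfolding L_def using \<epsilon> by (intro ln_mono) (auto simp: field_simps)
  have "exp 1 \<le> (4 :: real)" using exp_le by linarith
  then have "1 \<le> ln (4 :: real)" by (subst ln_ge_iff) auto
  then have L1: "1 \<le> L" using L4 by linarith
  interpret sampled_system A b n d xs "S\<^sup>2" "f\<^sup>2" "1 / \<kappa>\<^sup>2" R C
  proof
    show "f\<^sup>2 = (\<Sum>i<n. \<Sum>j<d. (A $$ (i, j))\<^sup>2)" using A by (simp add: f_def frobenius_norm_square)
    show "(\<Sum>j<d. (\<Sum>i<n. A $$ (i, j) * w i)\<^sup>2) \<le> S\<^sup>2 * (\<Sum>i<n. (w i)\<^sup>2)" for w
      unfolding S_def by (rule sum_transpose_mult_square_le_spectral[OF A])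
    show "i < n \<Longrightarrow> (\<Sum>j<d. (A $$ (i, j))\<^sup>2) \<le> S\<^sup>2" for i
      unfolding S_def by (rule row_square_le_spectral[OF A])
    have "1 / \<kappa>\<^sup>2 * S\<^sup>2 = 1 / T\<^sup>2" unfolding \<kappa> using S by (simp add: power_mult_distrib)
    then show "1 / \<kappa>\<^sup>2 * S\<^sup>2 * (\<Sum>j<d. ((\<Sum>i<n. A $$ (i, j) * w i) - xs j)\<^sup>2)
        \<le> (\<Sum>k<n. (\<Sum>j<d. A $$ (k, j) * ((\<Sum>i<n. A $$ (i, j) * w i) - xs j))\<^sup>2)" for w
      using sum_square_error_le[OF A bc, of w] T unfolding xs_def[abs_def] T_def
      by (simp add: divide_le_eq mult.commute)
    show "b $ i = (\<Sum>j<d. A $$ (i, j) * xs j)" if "i < n" for i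
    proof -
      have "pseudoinverse A *\<^sub>v b \<in> carrier_vec d" using pseudoinverse_carrier[OF A] bc by simp
      from mult_mat_vec_nth[OF A this that] show ?thesis
        using mult_pseudoinverse_mult_vec[OF A x0(1)] by (simp add: xs_def x0(2) del: index_mult_mat_vec)
    qed
    have "2 * \<phi>\<^sup>2 / \<kappa>\<^sup>2 \<le> R" unfolding R_def by (rule real_nat_ceiling_ge)
    then have "2 * (f\<^sup>2 / S\<^sup>2) \<le> R" using ratio by simp
    then show "2 * f\<^sup>2 \<le> S\<^sup>2 * R" using S by (simp add: field_simps)
    \<comment> \<open>The bound on \<open>\<epsilon>\<close> turns the factor 10 of \<open>C\<close>
      into the 160 = 10 * 16 of the locale.\<close>
    have "\<epsilon>\<^sup>2 \<le> (1 / 4)\<^sup>2" using \<epsilon> by (intro power_mono) auto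
    then have "10 * \<phi>\<^sup>2 / (1 / 4)\<^sup>2 \<le> 10 * \<phi>\<^sup>2 / \<epsilon>\<^sup>2"
      using \<epsilon> by (intro divide_left_mono) auto
    also have "\<dots> \<le> C" unfolding C_def by (rule real_nat_ceiling_ge)
    finally have "160 * \<phi>\<^sup>2 \<le> C" by (simp add: power2_eq_square)
    then have "1 / T\<^sup>2 * (160 * \<phi>\<^sup>2) \<le> 1 / T\<^sup>2 * C" by (intro mult_left_mono) auto
    then show "160 * f\<^sup>2 \<le> 1 / \<kappa>\<^sup>2 * S\<^sup>2 * C"
      unfolding \<open>1 / \<kappa>\<^sup>2 * S\<^sup>2 = 1 / T\<^sup>2\<close> \<phi> using T by (simp add: power_mult_distrib)
  qed (use A f S \<kappa>1 in auto)
  have K_ge: "4 * \<kappa>\<^sup>2 * L \<le> K" unfolding K_def by (rule real_nat_ceiling_ge)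
  have "4 * ln 4 \<le> 1 / \<kappa>\<^sup>2 * (4 * \<kappa>\<^sup>2 * L)" using \<kappa>1 L4 by simp
  also have "\<dots> \<le> 1 / \<kappa>\<^sup>2 * K" using K_ge by (intro mult_left_mono) auto
  finally have uK: "4 * ln 4 \<le> 1 / \<kappa>\<^sup>2 * K" .
  \<comment> \<open>Rounding up adds at most 1, which is absorbed here because
    \<open>\<phi>\<^sup>2 / \<kappa>\<^sup>2\<close> is at least 1, and for \<open>K\<close> because
    \<open>\<kappa>\<^sup>2 * L\<close> is.\<close>
  have "\<kappa>\<^sup>2 \<le> \<phi>\<^sup>2" using \<kappa>\<phi> \<kappa>1 by (intro power_mono) auto
  then have "1 \<le> \<phi>\<^sup>2 / \<kappa>\<^sup>2" using \<kappa>1 by simp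
  moreover have "real R \<le> 2 * \<phi>\<^sup>2 / \<kappa>\<^sup>2 + 1"
    unfolding R_def by (intro real_nat_ceiling_le) simp
  ultimately have R_le: "real R \<le> 3 * (\<phi>\<^sup>2 / \<kappa>\<^sup>2)" by simp
  have "1 \<le> \<kappa>\<^sup>2 * L" using \<kappa>1 L1 by (metis mult_mono' mult_1 one_le_power zero_le_one)
  moreover have "real K \<le> 4 * \<kappa>\<^sup>2 * L + 1"
    unfolding K_def using \<kappa>1 L1 by (intro real_nat_ceiling_le) simp
  ultimately have K_le: "real K \<le> 5 * (\<kappa>\<^sup>2 * L)" by simp
  have "3600000 * real R * real K ^ 3 \<le> 3600000 * (3 * (\<phi>\<^sup>2 / \<kappa>\<^sup>2)) * (5 * (\<kappa>\<^sup>2 * L)) ^ 3"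
    using R_le K_le by (intro mult_mono power_mono) auto
  also have "\<dots> = 1350000000 * \<phi>\<^sup>2 * \<kappa> ^ 4 * L ^ 3"
    using \<kappa>1 by (simp add: power_mult_distrib field_simps power2_eq_square power3_eq_cube power4_eq_xxxx)
  \<comment> \<open>The cube of \<open>K\<close> brings the sixth power of \<open>\<kappa>\<close>,
    of which \<open>R\<close> removes two; \<open>1 \<le> \<kappa>\<close> restores the exponent of
    the claim.\<close>
  also have "\<dots> \<le> 1350000000 * \<phi>\<^sup>2 * \<kappa> ^ 6 * L ^ 3"
    using \<kappa>1 L1 by (intro mult_right_mono mult_left_mono power_increasing) auto
  finally have "9 / 10 \<le> measure_pmf.prob (algo A b \<alpha> R C K)
      {y. phi A y \<le> ereal (1350000000 * \<phi>\<^sup>2 * \<kappa> ^ 6 * L ^ 3)}"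
    by (rule prob_phi_ge[OF uK])
  then show "9 / 10 \<le> measure_pmf.prob
      (algo A b (1 / (spectral_norm A)\<^sup>2) (nat \<lceil>2 * (kappa_F A)\<^sup>2 / (kappa A)\<^sup>2\<rceil>)
        (nat \<lceil>10 * (kappa_F A)\<^sup>2 / \<epsilon>\<^sup>2\<rceil>) (nat \<lceil>4 * (kappa A)\<^sup>2 * ln (1 / \<epsilon>)\<rceil>))
      {y. phi A y \<le> ereal (1350000000 * (kappa_F A)\<^sup>2 * kappa A ^ 6 * ln (1 / \<epsilon>) ^ 3)}"
    unfolding \<alpha>_def by (simp only: R_def C_def K_def L_def \<kappa>_def \<phi>_def S_def)
qed

end
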